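(* Let $T$ be a tree on $n$ vertices. Then $\gamma_{LD}(T)=\frac{n+\ell(T)-s(T)-sl(T)}{2}$ if and only if $T\in\mathcal{T}_{SL}$.
   Context: For an undirected graph $G=(V,E)$, $S\subseteq V$ is a locating-dominating set if every $u\notin S$ has $N(u)\cap S\neq\emptyset$ and distinct $u,v\notin S$ satisfy $N(u)\cap S\neq N(v)\cap S$; $\gamma_{LD}(G)$ is the minimum size. A leaf is a vertex of degree 1; a support vertex is a vertex adjacent to a leaf; a support link is a vertex that is neither a leaf nor a support vertex and all of whose neighbours are support vertices. $\ell(T)$, $s(T)$, $sl(T)$ denote the numbers of leaves, support vertices and support links of $T$; $S(T)$ is the set of support vertices. By convention, for the path $P_2$ one vertex is a support vertex and the other a leaf. Let $\mathcal{T}$ be the family of trees $T$ such that either $T=P_2$ or $\gamma_{LD}(T)=\frac{|V(T)|+\ell(T)-s(T)}{2}$. For trees $T_1,\dots,T_k$ with $k\geq 2$, the tree $\mathcal{SL}(T_1,\dots,T_k)$ is obtained from the disjoint union of $T_1,\dots,T_k$ by adding a new vertex $w$ and edges $v_iw$ for chosen vertices $v_i\in S(T_i)$, $1\leq i\leq k$. $\mathcal{T}_{SL}$ is the closure of $\mathcal{T}$ under this operation $\mathcal{SL}$ (the smallest family containing $\mathcal{T}$ and closed under $\mathcal{SL}$). *)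

theory Defs
  imports Complex_Main "HOL-Library.Disjoint_Sets" "Graph_Theory.Graph_Theory"
begin

definition nbhd :: "'a pair_pre_digraph \<Rightarrow> 'a \<Rightarrow> 'a set" where
  "nbhd G v = {u. (v, u) \<in> parcs G}"

(* Undirected simple graphs are symmetric loop-free pair digraphs (pair_graph).  The constant
   tree of Graph_Theory is not used, because for it the two arcs of an undirected edge already
   form a cycle (of length 2); the undirected cycles are the directed ones of length at least 3. *)
definition undirected_tree :: "'a pair_pre_digraph \<Rightarrow> bool" where
  "undirected_tree G \<longleftrightarrow>
     pair_graph G \<and> Digraph_Component.connected (with_proj G) \<and>
     \<not> (\<exists>p. pre_digraph.cycle (with_proj G) p \<and> 3 \<le> length p)"

definition locating_dominating :: "'a pair_pre_digraph \<Rightarrow> 'a set \<Rightarrow> bool" where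
  "locating_dominating G S \<longleftrightarrow>
     S \<subseteq> pverts G \<and>
     (\<forall>u \<in> pverts G - S. nbhd G u \<inter> S \<noteq> {}) \<and>
     (\<forall>u \<in> pverts G - S. \<forall>v \<in> pverts G - S. u \<noteq> v \<longrightarrow> nbhd G u \<inter> S \<noteq> nbhd G v \<inter> S)"

definition gamma_LD :: "'a pair_pre_digraph \<Rightarrow> nat" where
  "gamma_LD G = (LEAST k. \<exists>S. locating_dominating G S \<and> card S = k)"

definition is_P2 :: "'a pair_pre_digraph \<Rightarrow> bool" where
  "is_P2 G \<longleftrightarrow>
     (\<exists>u v. u \<noteq> v \<and> G = \<lparr> pverts = {u, v}, parcs = {(u, v), (v, u)} \<rparr>)"

(* By convention one vertex of the path on two vertices counts as support vertex and the other
   one as leaf.  Which one is chosen is immaterial: T_SL below is closed under isomorphism. *)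
definition support_vertices :: "'a pair_pre_digraph \<Rightarrow> 'a set" where
  "support_vertices G =
     (if is_P2 G then {SOME v. v \<in> pverts G}
      else {v \<in> pverts G. \<exists>u \<in> nbhd G v. card (nbhd G u) = 1})"

definition leaves :: "'a pair_pre_digraph \<Rightarrow> 'a set" where
  "leaves G =
     (if is_P2 G then pverts G - support_vertices G
      else {v \<in> pverts G. card (nbhd G v) = 1})"

definition support_links :: "'a pair_pre_digraph \<Rightarrow> 'a set" where
  "support_links G =
     {v \<in> pverts G. v \<notin> leaves G \<and> v \<notin> support_vertices G \<and> nbhd G v \<subseteq> support_vertices G}"

definition family_T :: "'a pair_pre_digraph set" where
  "family_T = {T. undirected_tree T \<and>
     (is_P2 T \<or>
      real (gamma_LD T) =
        (real (card (pverts T)) + real (card (leaves T)) - real (card (support_vertices T))) / 2)}"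

definition SL_join ::
    "nat \<Rightarrow> (nat \<Rightarrow> 'a pair_pre_digraph) \<Rightarrow> (nat \<Rightarrow> 'a) \<Rightarrow> 'a \<Rightarrow> 'a pair_pre_digraph" where
  "SL_join k T v w =
     \<lparr> pverts = insert w (\<Union>i\<in>{1..k}. pverts (T i)),
       parcs = (\<Union>i\<in>{1..k}. parcs (T i) \<union> {(v i, w), (w, v i)}) \<rparr>"

(* Trees are considered up to isomorphism, so the union of arbitrary members of the family is
   disjoint after renaming vertices: hence the disjointness premise together with rule iso. *)
inductive_set T_SL :: "'a pair_pre_digraph set" where
  base: "T \<in> family_T \<Longrightarrow> T \<in> T_SL"
| join: "\<lbrakk> 2 \<le> k;
           \<And>i. i \<in> {1..k} \<Longrightarrow> T i \<in> T_SL;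
           \<And>i. i \<in> {1..k} \<Longrightarrow> v i \<in> support_vertices (T i);
           disjoint_family_on (\<lambda>i. pverts (T i)) {1..k};
           w \<notin> (\<Union>i\<in>{1..k}. pverts (T i)) \<rbrakk>
         \<Longrightarrow> SL_join k T v w \<in> T_SL"
| iso: "\<lbrakk> T \<in> T_SL; digraph_iso (with_proj T) (with_proj T') \<rbrakk> \<Longrightarrow> T' \<in> T_SL"

end

(* The numbers l(T) - s(T) and sl(T) do not depend on the convention for P_2.

   A tree has a 2-colouring, and two vertices with the same neighbourhood in it are leaves at a
   common support. Put all but one leaf of every support aside: either colour class of the remaining
   n - (l - s) vertices, together with the l - s leaves set aside, is locating-dominating. Hence
   gamma_LD <= (n + l - s)/2.

   In a join SL(T_1, ..., T_k), gamma_LD and (n + l - s - sl)/2 are both the sums over the T_i, because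
   optimal sets can be chosen to contain the attaching supports. Conversely, deleting a support
   link w splits a tree into smaller trees whose join at w it is. By induction
   gamma_LD <= (n + l - s - sl)/2 for every tree with at least two vertices, with equality if and only
   if equality holds for all pieces. A tree with gamma_LD = (n + l - s)/2 therefore has sl = 0. *)

theory Submission
  imports Defs "HOL-Combinatorics.Transposition"
begin

section \<open>Trees as connected graphs all of whose edges are bridges\<close>

text \<open>Acyclicity is used in the form that every edge is a bridge. This drives the 2-colouring,
  forbids two vertices with two common neighbours, and keeps the pieces at a support link apart.
  Additivity over joins is proved for the wider class \<open>proper_graph\<close>, which passes
  easily to joins, so the induction over \<open>T_SL\<close> never has to recognise a join as a
  tree. The delicate piece is P_2: once one of its vertices is attached, this vertex is no longer a
  leaf and the other one is no longer a support. A leaf and a support disappear together, so the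
  counts are arranged to involve only the difference l - s. Moreover, a splitting may attach a P_2
  at the very vertex that the convention calls its leaf.\<close>

lemma pair_graph_iff:
  "pair_graph G \<longleftrightarrow> finite (pverts G) \<and> parcs G \<subseteq> pverts G \<times> pverts G \<and> sym (parcs G) \<and> irrefl (parcs G)"
proof
  assume "pair_graph G"
  then interpret pair_graph G .
  show "finite (pverts G) \<and> parcs G \<subseteq> pverts G \<times> pverts G \<and> sym (parcs G) \<and> irrefl (parcs G)"
    using no_loops' by (auto simp: irrefl_def sym_def dest: arcs_symmetric in_arcsD1 in_arcsD2)
next
  assume *: "finite (pverts G) \<and> parcs G \<subseteq> pverts G \<times> pverts G \<and> sym (parcs G) \<and> irrefl (parcs G)"
  then have "finite (parcs G)" by (meson finite_SigmaI finite_subset)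
  with * show "pair_graph G"
    by unfold_locales (auto simp: symmetric_def irrefl_def)
qed

text \<open>Symmetry makes the symmetric closure in the library notion collapse, which leaves plain
  reachability by \<open>rtrancl\<close>.\<close>

lemma connected_iff:
  assumes "pair_graph G"
  shows "Digraph_Component.connected (with_proj G) \<longleftrightarrow>
    pverts G \<noteq> {} \<and> (\<forall>u\<in>pverts G. \<forall>v\<in>pverts G. (u, v) \<in> (parcs G)\<^sup>*)"
proof -
  interpret pair_graph G by fact
  have "symcl (parcs G) = parcs G"
    using assms by (auto simp: symcl_def pair_graph_iff sym_def)
  moreover have "(u, v) \<in> rtrancl_on (pverts G) (parcs G) \<longleftrightarrow> (u, v) \<in> (parcs G)\<^sup>*"
    if "u \<in> pverts G" for u v
    using reachable_conv'[OF that, of v] by (simp add: reachable_def)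
  ultimately show ?thesis
    by (simp add: connected_conv)
qed

text \<open>Acyclicity of a symmetric relation, stated without walks so that edges can be deleted in
  an induction. Loops are excluded too, because the closure is reflexive.\<close>

definition bridged :: "'a rel \<Rightarrow> bool" where
  "bridged E \<longleftrightarrow> (\<forall>u v. (u, v) \<in> E \<longrightarrow> (u, v) \<notin> (E - {(u, v), (v, u)})\<^sup>*)"

lemma bridgedD: "bridged E \<Longrightarrow> (u, v) \<in> E \<Longrightarrow> (u, v) \<notin> (E - {(u, v), (v, u)})\<^sup>*"
  by (simp add: bridged_def)

lemma bridged_irrefl: "bridged E \<Longrightarrow> (u, v) \<in> E \<Longrightarrow> u \<noteq> v"
  using bridgedD[of E u u] by auto

lemma bridged_subset:
  assumes "bridged E" "F \<subseteq> E"
  shows "bridged F"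
  unfolding bridged_def
proof (intro allI impI)
  fix u v assume "(u, v) \<in> F"
  then have "(u, v) \<notin> (E - {(u, v), (v, u)})\<^sup>*"
    using bridgedD[OF assms(1) subsetD[OF assms(2)]] by simp
  moreover have "(F - {(u, v), (v, u)})\<^sup>* \<subseteq> (E - {(u, v), (v, u)})\<^sup>*"
    using assms(2) by (intro rtrancl_mono) blast
  ultimately show "(u, v) \<notin> (F - {(u, v), (v, u)})\<^sup>*"
    by (meson subsetD)
qed

text \<open>Otherwise u, y, v, x would form a 4-cycle: the walk u - y - v - x bypasses the edge
  ux.\<close>

lemma bridged_common_neighbour:
  assumes "bridged E" "sym E" "(u, x) \<in> E" "(u, y) \<in> E" "(v, x) \<in> E" "(v, y) \<in> E" "u \<noteq> v"
  shows "x = y"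
proof (rule ccontr)
  assume "x \<noteq> y"
  let ?F = "E - {(u, x), (x, u)}"
  have "u \<noteq> x" "v \<noteq> x" "u \<noteq> y" "v \<noteq> y"
    using assms bridged_irrefl by metis+
  then have "(u, y) \<in> ?F" "(y, v) \<in> ?F" "(v, x) \<in> ?F"
    using assms \<open>x \<noteq> y\<close> by (auto dest: symD)
  then have "(u, x) \<in> ?F\<^sup>*" by (meson converse_rtrancl_into_rtrancl r_into_rtrancl)
  then show False using bridgedD[OF assms(1,3)] by blast
qed

text \<open>Colour the relation without one edge uv. Its ends lie in different components of the
  rest, so if they received the same colour, the component of u can be flipped without harming any
  other edge.\<close>

lemma bridged_two_colourable:
  assumes "finite E" "sym E" "bridged E"
  shows "\<exists>c. \<forall>(u, v)\<in>E. c u \<noteq> (c v :: bool)"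
  using assms
proof (induction "card E" arbitrary: E rule: less_induct)
  case less
  show ?case
  proof (cases "E = {}")
    case False
    then obtain u v where uv: "(u, v) \<in> E" by auto
    define F where "F = E - {(u, v), (v, u)}"
    have "F \<subset> E" using uv F_def by blast
    then have "card F < card E" using less.prems psubset_card_mono by blast
    moreover have symF: "sym F" using less.prems unfolding F_def sym_def by blast
    moreover have "bridged F"
      by (rule bridged_subset[OF less.prems(3)]) (auto simp: F_def)
    moreover have "finite F" using less.prems F_def by simp
    ultimately have "\<exists>c. \<forall>(a, b)\<in>F. c a \<noteq> (c b :: bool)"
      using less.hyps[of F] by blast
    then obtain c where c: "\<And>a b. (a, b) \<in> F \<Longrightarrow> c a \<noteq> (c b :: bool)"
      by blast
    define d where "d = (\<lambda>x. if c u = c v \<and> (u, x) \<in> F\<^sup>* then \<not> c x else c x)"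
    have nuv: "(u, v) \<notin> F\<^sup>*"
      unfolding F_def by (rule bridgedD[OF less.prems(3) uv])
    have "d a \<noteq> d b" if "(a, b) \<in> F" for a b
    proof -
      have "(u, a) \<in> F\<^sup>* \<longleftrightarrow> (u, b) \<in> F\<^sup>*"
        using that symD[OF symF that] rtrancl_into_rtrancl by metis
      with c[OF that] show ?thesis by (auto simp: d_def)
    qed
    moreover have "d u \<noteq> d v"
      using nuv by (simp add: d_def)
    moreover have "(a, b) \<in> F \<or> a = u \<and> b = v \<or> a = v \<and> b = u" if "(a, b) \<in> E" for a b
      using that by (auto simp: F_def)
    ultimately have "d a \<noteq> d b" if "(a, b) \<in> E" for a b
      using that by blast
    then have "\<forall>(a, b)\<in>E. d a \<noteq> d b" by blast
    then show ?thesis by (rule exI[of _ d])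
  qed auto
qed

text \<open>A path from u to v that avoids the edge uv is closed to a cycle by the arc from v to
  u.\<close>

lemma undirected_tree_bridged:
  assumes "undirected_tree G"
  shows "bridged (parcs G)"
  unfolding bridged_def
proof (intro allI impI notI)
  fix u v assume uv: "(u, v) \<in> parcs G" and reach: "(u, v) \<in> (parcs G - {(u, v), (v, u)})\<^sup>*"
  interpret pair_graph G using assms by (simp add: undirected_tree_def)
  define H where "H = \<lparr>pverts = pverts G, parcs = parcs G - {(u, v), (v, u)}\<rparr>"
  interpret H: pair_wf_digraph H
    by unfold_locales (auto simp: H_def dest: in_arcsD1 in_arcsD2)
  have H_sub: "pverts H = pverts G" "parcs H \<subseteq> parcs G" by (auto simp: H_def)
  have "u \<in> pverts H" using uv in_arcsD1 by (simp add: H_def)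
  then have "reachable (with_proj H) u v"
    using reach H.reachable_conv'[of u v] by (simp add: H_def)
  then obtain p where p: "H.apath u p v" using H.reachable_apath by blast
  then have awalk: "awalk u p v"
    using H_sub by (auto simp: H.apath_def H.awalk_def awalk_def)
  moreover have "(v, u) \<in> parcs G" using uv by (simp add: arcs_symmetric)
  ultimately have "awalk v ((v, u) # p) v"
    by (auto simp: awalk_Cons_iff)
  moreover have "distinct (tl (awalk_verts v ((v, u) # p)))"
    using p by (simp add: H.apath_def)
  ultimately have "cycle ((v, u) # p)" by (auto simp: cycle_def)
  \<comment> \<open>The path is nonempty as there are no loops, and it is not a single arc because
    that arc would be the removed \<open>(u, v)\<close>.\<close>
  moreover have "3 \<le> length ((v, u) # p)"
  proof -
    have "u \<noteq> v" using no_loops'[OF uv] .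
    then have "p \<noteq> []" using awalk by (auto simp: awalk_Nil_iff)
    moreover have "p \<noteq> [e]" for e
    proof
      assume "p = [e]"
      then have "(u, v) \<in> parcs H"
        using p by (cases e) (auto simp: H.apath_def H.awalk_Cons_iff H.awalk_Nil_iff)
      then show False by (simp add: H_def)
    qed
    ultimately show ?thesis by (cases p rule: list_exhaust_NSC) auto
  qed
  ultimately show False using assms by (auto simp: undirected_tree_def)
qed

lemma undirected_treeD:
  assumes "undirected_tree G"
  shows "pair_graph G" "pverts G \<noteq> {}" "bridged (parcs G)"
    "u \<in> pverts G \<Longrightarrow> v \<in> pverts G \<Longrightarrow> (u, v) \<in> (parcs G)\<^sup>*"
  using assms undirected_tree_bridged connected_iff by (auto simp: undirected_tree_def)

text \<open>Every cycle of a subgraph is a cycle of the whole graph, so only connectedness has to be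
  supplied; for components it holds by construction.\<close>

lemma undirected_tree_subgraph:
  assumes "undirected_tree G" "pair_graph H" "pverts H \<subseteq> pverts G" "parcs H \<subseteq> parcs G"
    "pverts H \<noteq> {}" "\<And>u v. u \<in> pverts H \<Longrightarrow> v \<in> pverts H \<Longrightarrow> (u, v) \<in> (parcs H)\<^sup>*"
  shows "undirected_tree H"
proof -
  interpret G: pair_graph G using assms by (simp add: undirected_tree_def)
  interpret H: pair_graph H by fact
  have "subgraph (with_proj H) (with_proj G)"
    using assms by (auto intro!: subgraphI G.wf_digraph H.wf_digraph)
  then have "G.cycle p" if "H.cycle p" for p
    using G.subgraph_cycle that by blast
  then show ?thesis
    using assms by (auto simp: undirected_tree_def connected_iff)
qed

section \<open>Leaves, supports and locating-dominating sets\<close>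

lemma mem_nbhd [simp]: "u \<in> nbhd G v \<longleftrightarrow> (v, u) \<in> parcs G"
  by (simp add: nbhd_def)

lemma pair_graphD:
  assumes "pair_graph G"
  shows "finite (pverts G)" "(u, v) \<in> parcs G \<Longrightarrow> u \<in> pverts G" "(u, v) \<in> parcs G \<Longrightarrow> v \<in> pverts G"
    "(u, v) \<in> parcs G \<Longrightarrow> (v, u) \<in> parcs G" "(u, u) \<notin> parcs G" "finite (nbhd G u)"
proof -
  show "finite (pverts G)" "(u, v) \<in> parcs G \<Longrightarrow> u \<in> pverts G" "(u, v) \<in> parcs G \<Longrightarrow> v \<in> pverts G"
    "(u, v) \<in> parcs G \<Longrightarrow> (v, u) \<in> parcs G" "(u, u) \<notin> parcs G"
    using assms by (auto simp: pair_graph_iff sym_def irrefl_def)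
  have "nbhd G u \<subseteq> pverts G" using assms by (auto simp: pair_graph_iff)
  then show "finite (nbhd G u)" using assms finite_subset by (auto simp: pair_graph_iff)
qed

text \<open>The sets below treat both vertices of $P_2$ as leaves and as supports. The difference of the
  numbers of leaves and supports, and the support links, are the same as under the convention of
  the definitions.\<close>

definition leaf_set :: "'a pair_pre_digraph \<Rightarrow> 'a set" where
  "leaf_set G = {v \<in> pverts G. card (nbhd G v) = 1}"

definition support_set :: "'a pair_pre_digraph \<Rightarrow> 'a set" where
  "support_set G = {v \<in> pverts G. \<exists>u \<in> nbhd G v. card (nbhd G u) = 1}"

definition link_set :: "'a pair_pre_digraph \<Rightarrow> 'a set" where
  "link_set G = {v \<in> pverts G. v \<notin> leaf_set G \<and> v \<notin> support_set G \<and> nbhd G v \<subseteq> support_set G}"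

lemma is_P2_sets:
  assumes "is_P2 G"
  shows "leaf_set G = pverts G" "support_set G = pverts G" "support_vertices G \<subseteq> pverts G"
    "card (pverts G) = 2" "card (support_vertices G) = 1"
proof -
  obtain u v where uv: "u \<noteq> v" "G = \<lparr>pverts = {u, v}, parcs = {(u, v), (v, u)}\<rparr>"
    using assms by (auto simp: is_P2_def)
  have n: "nbhd G u = {v}" "nbhd G v = {u}" using uv by (auto simp: nbhd_def)
  show "leaf_set G = pverts G" "support_set G = pverts G" "card (pverts G) = 2"
    using n uv by (auto simp: leaf_set_def support_set_def)
  show "support_vertices G \<subseteq> pverts G"
    using assms someI[of "\<lambda>x. x \<in> pverts G" u] uv(2) by (simp add: support_vertices_def)
  show "card (support_vertices G) = 1"
    using assms by (simp add: support_vertices_def)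
qed

lemma support_vertices_subset: "support_vertices G \<subseteq> support_set G"
proof (cases "is_P2 G")
  case True
  then show ?thesis using is_P2_sets(2,3)[OF True] by simp
qed (auto simp: support_vertices_def support_set_def)

text \<open>For P_2 the two sides are 1 - 1 and 2 - 2.\<close>

lemma leaves_diff_supports:
  assumes "pair_graph G"
  shows "real (card (leaves G)) - real (card (support_vertices G)) =
    real (card (leaf_set G)) - real (card (support_set G))"
proof (cases "is_P2 G")
  case True
  have "card (leaves G) = card (pverts G) - card (support_vertices G)"
    using True is_P2_sets(3)[OF True] finite_subset[OF is_P2_sets(3)[OF True] pair_graphD(1)[OF assms]]
    by (simp add: leaves_def card_Diff_subset)
  then show ?thesis using is_P2_sets[OF True] by simp
qed (simp add: leaves_def leaf_set_def support_vertices_def support_set_def)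

lemma support_links_eq: "support_links G = link_set G"
proof (cases "is_P2 G")
  case True
  then show ?thesis using is_P2_sets[OF True]
    by (auto simp: support_links_def link_set_def leaves_def)
qed (simp add: leaves_def leaf_set_def support_vertices_def support_set_def support_links_def link_set_def)

section \<open>Minimum locating-dominating sets and exchanges at a support\<close>

lemma locating_dominatingI:
  assumes "S \<subseteq> pverts G"
    and "\<And>u. u \<in> pverts G \<Longrightarrow> u \<notin> S \<Longrightarrow> nbhd G u \<inter> S \<noteq> {}"
    and "\<And>u v. u \<in> pverts G \<Longrightarrow> u \<notin> S \<Longrightarrow> v \<in> pverts G \<Longrightarrow> v \<notin> S \<Longrightarrow> nbhd G u \<inter> S = nbhd G v \<inter> S \<Longrightarrow> u = v"
  shows "locating_dominating G S"
  using assms unfolding locating_dominating_def by blast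

lemma locating_dominatingD:
  assumes "locating_dominating G S"
  shows "S \<subseteq> pverts G"
    and "u \<in> pverts G \<Longrightarrow> u \<notin> S \<Longrightarrow> nbhd G u \<inter> S \<noteq> {}"
    and "u \<in> pverts G \<Longrightarrow> u \<notin> S \<Longrightarrow> v \<in> pverts G \<Longrightarrow> v \<notin> S \<Longrightarrow> nbhd G u \<inter> S = nbhd G v \<inter> S \<Longrightarrow> u = v"
  using assms unfolding locating_dominating_def by blast+

lemma gamma_LD_le: "locating_dominating G S \<Longrightarrow> gamma_LD G \<le> card S"
  unfolding gamma_LD_def by (auto intro: Least_le)

text \<open>The whole vertex set qualifies vacuously, so the \<open>LEAST\<close> ranges over a
  nonempty set.\<close>

lemma gamma_LD_attained:
  obtains S where "locating_dominating G S" "card S = gamma_LD G"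
proof -
  have "locating_dominating G (pverts G)" by (rule locating_dominatingI) auto
  then have "\<exists>k S. locating_dominating G S \<and> card S = k" by blast
  then have "\<exists>S. locating_dominating G S \<and> card S = gamma_LD G"
    unfolding gamma_LD_def by (rule LeastI_ex)
  with that show ?thesis by blast
qed

text \<open>If \<open>v \<notin> S\<close>, then \<open>S\<close> contains a leaf at \<open>v\<close>, which can be exchanged for \<open>v\<close>.\<close>

lemma locating_dominating_exchange:
  assumes G: "pair_graph G" and v: "v \<in> support_set G" and S: "S \<subseteq> pverts G"
    and dom: "\<And>u. u \<in> pverts G \<Longrightarrow> u \<notin> S \<Longrightarrow> u \<noteq> v \<Longrightarrow> nbhd G u \<inter> S \<noteq> {}"
    and loc: "\<And>u x. u \<in> pverts G \<Longrightarrow> u \<notin> S \<Longrightarrow> u \<noteq> v \<Longrightarrow> x \<in> pverts G \<Longrightarrow> x \<notin> S \<Longrightarrow> x \<noteq> v \<Longrightarrow>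
      nbhd G u \<inter> S = nbhd G x \<inter> S \<Longrightarrow> u = x"
  obtains S' where "locating_dominating G S'" "v \<in> S'" "card S' = card S"
proof (cases "v \<in> S")
  case True
  have "locating_dominating G S"
  proof (rule locating_dominatingI)
    fix u assume "u \<in> pverts G" "u \<notin> S"
    then show "nbhd G u \<inter> S \<noteq> {}" using dom True by blast
  next
    fix u x assume "u \<in> pverts G" "u \<notin> S" "x \<in> pverts G" "x \<notin> S" "nbhd G u \<inter> S = nbhd G x \<inter> S"
    then show "u = x" using loc True by blast
  qed (fact S)
  then show ?thesis using that True by blast
next
  case False
  obtain l where l: "(v, l) \<in> parcs G" "card (nbhd G l) = 1"
    using v by (auto simp: support_set_def)
  then have nl: "nbhd G l = {v}"
    using pair_graphD(4)[OF G l(1)] by (metis card_1_singletonE mem_nbhd singletonD)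
  have "l \<in> pverts G" "l \<noteq> v" "v \<in> pverts G"
    using l pair_graphD[OF G] by metis+
  \<comment> \<open>The only neighbour \<open>v\<close> of \<open>l\<close> lies outside
    \<open>S\<close>, so nothing could dominate \<open>l\<close>.\<close>
  then have "l \<in> S" using dom[of l] nl False by auto
  have only: "u = v" if "(u, l) \<in> parcs G" for u
    using pair_graphD(4)[OF G that] nl by (metis mem_nbhd singletonD)
  define S' where "S' = insert v (S - {l})"
  \<comment> \<open>Only \<open>v\<close> is adjacent to \<open>l\<close>, so for every other vertex
    the exchange changes the trace at most by adding \<open>v\<close>.\<close>
  have restrict: "(nbhd G u \<inter> S') - {v} = nbhd G u \<inter> S" if "u \<noteq> v" for u
    using only that False by (auto simp: S'_def)
  have outside: "u \<noteq> v \<and> (u = l \<or> u \<notin> S)" if "u \<notin> S'" for u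
    using that by (auto simp: S'_def)
  have "locating_dominating G S'"
  proof (rule locating_dominatingI)
    show "S' \<subseteq> pverts G" using S \<open>v \<in> pverts G\<close> by (auto simp: S'_def)
  next
    fix u assume u: "u \<in> pverts G" "u \<notin> S'"
    show "nbhd G u \<inter> S' \<noteq> {}"
    proof (cases "u = l")
      case True
      then show ?thesis using nl by (simp add: S'_def)
    next
      case False
      then show ?thesis using u outside dom restrict by blast
    qed
  next
    \<comment> \<open>\<open>l\<close> now sees only \<open>v\<close>, whereas every other vertex
      outside \<open>S'\<close> still sees an element of the old \<open>S\<close>, which does not
      contain \<open>v\<close>.\<close>
    have key: "u = l" if "u \<in> pverts G" "u \<notin> S'" "nbhd G u \<inter> S' = nbhd G l \<inter> S'" for u
    proof (rule ccontr)
      assume "u \<noteq> l"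
      then have "nbhd G u \<inter> S \<noteq> {}" "u \<noteq> v" using that outside dom by blast+
      then show False using restrict that(3) nl by blast
    qed
    fix u x assume u: "u \<in> pverts G" "u \<notin> S'" and x: "x \<in> pverts G" "x \<notin> S'"
      and eq: "nbhd G u \<inter> S' = nbhd G x \<inter> S'"
    show "u = x"
    proof (cases "u = l \<or> x = l")
      case True
      then show ?thesis using key u x eq by metis
    next
      case False
      then show ?thesis using loc u x outside restrict eq by metis
    qed
  qed
  moreover have "card S' = card S"
    using \<open>l \<in> S\<close> False S pair_graphD(1)[OF G] finite_subset
    by (metis S'_def card.remove card.insert finite_Diff Diff_iff)
  ultimately show ?thesis using that by (auto simp: S'_def)
qed

text \<open>The part of being a tree with at least two vertices on which the join computations rest:
  no isolated vertices, and adjacent leaves only in P_2. Connectedness is not demanded.\<close>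

definition proper_graph :: "'a pair_pre_digraph \<Rightarrow> bool" where
  "proper_graph G \<longleftrightarrow> pair_graph G \<and> (\<forall>v\<in>pverts G. nbhd G v \<noteq> {}) \<and>
     (\<forall>u v. (u, v) \<in> parcs G \<longrightarrow> card (nbhd G u) = 1 \<longrightarrow> card (nbhd G v) = 1 \<longrightarrow> pverts G = {u, v})"

text \<open>Two adjacent leaves are closed under adjacency, so by connectedness they are the whole
  tree.\<close>

lemma undirected_tree_proper:
  assumes T: "undirected_tree T" and "card (pverts T) \<noteq> 1"
  shows "proper_graph T"
proof -
  note G = undirected_treeD[OF T]
  show ?thesis
    unfolding proper_graph_def
  proof (intro conjI ballI allI impI)
    fix v assume v: "v \<in> pverts T"
    have "\<exists>u\<in>pverts T. u \<noteq> v"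
    proof (rule ccontr)
      assume "\<not> ?thesis"
      then have "pverts T = {v}" using v by blast
      then show False using assms by simp
    qed
    then obtain u where "u \<in> pverts T" "u \<noteq> v" by blast
    then have "(v, u) \<in> (parcs T)\<^sup>*" "u \<noteq> v" using G(4) v by auto
    then show "nbhd T v \<noteq> {}" by (metis converse_rtranclE empty_iff mem_nbhd)
  next
    fix u v assume uv: "(u, v) \<in> parcs T" and "card (nbhd T u) = 1" "card (nbhd T v) = 1"
    then have n: "nbhd T u = {v}" "nbhd T v = {u}"
      using pair_graphD(4)[OF G(1) uv] by (metis card_1_singletonE mem_nbhd singletonD)+
    have "x \<in> {u, v}" if "(u, x) \<in> (parcs T)\<^sup>*" for x
      using that
    proof induction
      case (step y z)
      then have "z \<in> nbhd T y" by simp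
      then show ?case using step n by auto
    qed simp
    then show "pverts T = {u, v}"
      using G(4) pair_graphD(2,3)[OF G(1) uv] by blast
  qed (fact G(1))
qed

lemma neighbour_of_leaf:
  assumes "card (nbhd G l) = 1" "(l, u) \<in> parcs G" "(l, v) \<in> parcs G"
  shows "u = v"
  using assms by (metis card_1_singletonE mem_nbhd singletonD)

text \<open>Delete all but one leaf at every support. Each colour class of the remaining tree, together
  with the deleted leaves, is locating-dominating: two vertices with the same neighbourhood in a
  tree are leaves at a common support.\<close>

lemma gamma_LD_leaf_support_bound:
  assumes T: "undirected_tree T" and "card (pverts T) \<noteq> 1"
  shows "2 * real (gamma_LD T) \<le>
    real (card (pverts T)) + real (card (leaf_set T)) - real (card (support_set T))"
proof -
  note G = undirected_treeD[OF T] and P = pair_graphD[OF undirected_treeD(1)[OF T]]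
  have ne: "nbhd T v \<noteq> {}" if "v \<in> pverts T" for v
    using undirected_tree_proper[OF assms] that by (simp add: proper_graph_def)
  have "finite (parcs T)" "sym (parcs T)"
    using G(1) finite_subset[of "parcs T" "pverts T \<times> pverts T"] by (auto simp: pair_graph_iff)
  note symT = this(2)
  from \<open>finite (parcs T)\<close> symT obtain c where "\<forall>(u, v)\<in>parcs T. c u \<noteq> (c v :: bool)"
    using bridged_two_colourable G(3) by blast
  then have c: "\<And>u v. (u, v) \<in> parcs T \<Longrightarrow> c u \<noteq> c v" by blast
  have "\<forall>v. \<exists>l. v \<in> support_set T \<longrightarrow> (v, l) \<in> parcs T \<and> card (nbhd T l) = 1"
    by (auto simp: support_set_def)
  then obtain ch where
    ch: "\<And>v. v \<in> support_set T \<Longrightarrow> (v, ch v) \<in> parcs T \<and> card (nbhd T (ch v)) = 1"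
    by metis
  define C where "C = ch ` support_set T"
  define L where "L = leaf_set T - C"
  \<comment> \<open>A leaf has a single neighbour, so different supports keep different leaves. This
    gives \<open>L\<close> exactly l - s elements; for P_2 each vertex is the leaf kept by the
    other.\<close>
  have inj: "inj_on ch (support_set T)"
    using ch P(4) neighbour_of_leaf by (metis inj_onI)
  have CL: "C \<subseteq> leaf_set T"
    using ch P(3) by (auto simp: C_def leaf_set_def)
  have LV: "L \<subseteq> pverts T" by (auto simp: L_def leaf_set_def)
  have fin: "finite (leaf_set T)" "finite L" "finite C"
    using P(1) CL by (auto simp: leaf_set_def L_def finite_subset)
  have "card L = card (leaf_set T) - card (support_set T)" "card (support_set T) \<le> card (leaf_set T)"
    using card_image[OF inj] fin CL card_mono[OF fin(1) CL]
    by (simp_all add: L_def C_def[symmetric] card_Diff_subset)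
  then have cardL: "real (card L) = real (card (leaf_set T)) - real (card (support_set T))"
    by simp
  have bound: "gamma_LD T \<le> card {x \<in> pverts T - L. c x = b} + card L" for b
  proof -
    let ?S = "{x \<in> pverts T - L. c x = b} \<union> L"
    \<comment> \<open>The neighbours of a vertex of the wrong colour all have colour
      \<open>b\<close>; those removed from the colour class lie in \<open>L\<close>. Hence
      \<open>?S\<close> sees whole neighbourhoods.\<close>
    have nbh: "nbhd T u \<inter> ?S = nbhd T u" if "u \<in> pverts T" "u \<notin> ?S" for u
    proof -
      have "c u \<noteq> b" using that by blast
      then show ?thesis using c P(3) by fastforce
    qed
    have "locating_dominating T ?S"
    proof (rule locating_dominatingI)
      show "?S \<subseteq> pverts T" using LV by blast
    next
      fix u assume "u \<in> pverts T" "u \<notin> ?S"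
      then show "nbhd T u \<inter> ?S \<noteq> {}" using nbh[of u] ne[of u] by metis
    next
      fix u v assume u: "u \<in> pverts T" "u \<notin> ?S" and v: "v \<in> pverts T" "v \<notin> ?S"
        and "nbhd T u \<inter> ?S = nbhd T v \<inter> ?S"
      then have eq: "nbhd T u = nbhd T v" using nbh[of u] nbh[of v] by metis
      obtain s where s: "(u, s) \<in> parcs T" using ne[OF u(1)] by auto
      show "u = v"
      proof (rule ccontr)
        assume "u \<noteq> v"
        have "y = s" if "(u, y) \<in> parcs T" for y
        proof (rule bridged_common_neighbour[OF G(3) symT that s _ _ \<open>u \<noteq> v\<close>])
          show "(v, y) \<in> parcs T" "(v, s) \<in> parcs T"
            using that s eq unfolding nbhd_def by blast+
        qed
        then have nu: "nbhd T u = {s}"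
          using s unfolding nbhd_def by blast
        then have nv: "nbhd T v = {s}" using eq by simp
        have "u \<in> leaf_set T" "v \<in> leaf_set T" using nu nv u v by (simp_all add: leaf_set_def)
        \<comment> \<open>Leaves outside \<open>?S\<close> are not in \<open>L\<close>, so both were
          kept; but the common support \<open>s\<close> keeps only one leaf.\<close>
        then have "u \<in> C" "v \<in> C" using u v unfolding L_def by blast+
        then obtain a b where "u = ch a" "v = ch b" "a \<in> support_set T" "b \<in> support_set T"
          by (auto simp: C_def)
        moreover from this have "(u, a) \<in> parcs T" "(v, b) \<in> parcs T"
          using ch P(4) by blast+
        then have "a = s" "b = s"
          using nu nv unfolding nbhd_def by blast+
        ultimately show False using \<open>u \<noteq> v\<close> by simp
      qed
    qed
    then have "gamma_LD T \<le> card ?S" by (rule gamma_LD_le)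
    also have "\<dots> \<le> card {x \<in> pverts T - L. c x = b} + card L" by (rule card_Un_le)
    finally show ?thesis .
  qed
  have "card {x \<in> pverts T - L. c x = True} + card {x \<in> pverts T - L. c x = False} = card (pverts T - L)"
    using P(1) by (subst card_Un_disjoint[symmetric]) (auto intro: arg_cong[where f = card])
  moreover have "card (pverts T - L) + card L = card (pverts T)"
    using card_Diff_subset[OF fin(2) LV] card_mono[OF P(1) LV] by simp
  \<comment> \<open>The two colour classes together have n - \<open>card L\<close> elements, while
    \<open>card L\<close> enters once for each colour.\<close>
  ultimately have "2 * gamma_LD T \<le> card (pverts T) + card L"
    using bound[of True] bound[of False] by linarith
  then have "real (2 * gamma_LD T) \<le> real (card (pverts T) + card L)"
    by (simp only: of_nat_le_iff)
  then show ?thesis using cardL by simp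
qed

section \<open>Joining graphs at supports\<close>

text \<open>In a join, \<open>v\<close> gets a new neighbour: it is no longer a leaf and makes no neighbour a support.
  This matters only for $P_2$.\<close>

lemma proper_graph_support:
  assumes G: "proper_graph G" and v: "v \<in> support_set G"
  defines "L \<equiv> leaf_set G - {v}"
    and "R \<equiv> {x \<in> pverts G. x = v \<or> (\<exists>u\<in>nbhd G x. u \<noteq> v \<and> card (nbhd G u) = 1)}"
  shows "real (card L) - real (card R) = real (card (leaf_set G)) - real (card (support_set G))"
    and "{x \<in> pverts G. x \<notin> L \<and> x \<notin> R \<and> nbhd G x \<subseteq> R} = link_set G"
proof -
  have P: "pair_graph G" using G by (simp add: proper_graph_def)
  note PD = pair_graphD[OF P]
  obtain l where l: "(v, l) \<in> parcs G" "card (nbhd G l) = 1"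
    using v by (auto simp: support_set_def)
  have vV: "v \<in> pverts G" and "l \<in> pverts G" "l \<noteq> v" using l PD by metis+
  have "real (card L) - real (card R) = real (card (leaf_set G)) - real (card (support_set G)) \<and>
    {x \<in> pverts G. x \<notin> L \<and> x \<notin> R \<and> nbhd G x \<subseteq> R} = link_set G"
  proof (cases "card (nbhd G v) = 1")
    case True
    \<comment> \<open>The attached vertex and its leaf are adjacent leaves, so this is P_2;
      \<open>L\<close> and \<open>R\<close> each lose one vertex, but not the same one.\<close>
    then have V: "pverts G = {v, l}"
      using G l by (simp add: proper_graph_def)
    have "nbhd G l = {v}" "nbhd G v = {l}"
      using l True PD(4)[OF l(1)] by (metis card_1_singletonE mem_nbhd singletonD)+
    then have "leaf_set G = {v, l}" "support_set G = {v, l}" "L = {l}" "R = {v}"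
      using V \<open>l \<noteq> v\<close> by (auto simp: leaf_set_def support_set_def L_def R_def)
    then show ?thesis using V \<open>l \<noteq> v\<close> by (auto simp: link_set_def)
  next
    case False
    then have "L = leaf_set G" by (auto simp: L_def leaf_set_def)
    moreover have "R = support_set G"
      using False v vV by (auto simp: R_def support_set_def)
    ultimately show ?thesis by (auto simp: link_set_def)
  qed
  then show "real (card L) - real (card R) = real (card (leaf_set G)) - real (card (support_set G))"
    and "{x \<in> pverts G. x \<notin> L \<and> x \<notin> R \<and> nbhd G x \<subseteq> R} = link_set G" by auto
qed

text \<open>The right-hand side of the theorem in terms of the symmetric sets; real-valued so that
  the subtractions are genuine and sums over pieces behave.\<close>

definition ld_value :: "'a pair_pre_digraph \<Rightarrow> real" where
  "ld_value G = (real (card (pverts G)) + real (card (leaf_set G)) - real (card (support_set G))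
     - real (card (link_set G))) / 2"

text \<open>General enough for both directions: the pieces may come from \<open>T_SL\<close> or from
  splitting a tree, and in a P_2 either vertex may be attached.\<close>

locale support_join =
  fixes k :: nat and T :: "nat \<Rightarrow> 'a pair_pre_digraph" and v :: "nat \<Rightarrow> 'a" and w :: 'a
  assumes two_le: "2 \<le> k"
    and proper: "i \<in> {1..k} \<Longrightarrow> proper_graph (T i)"
    and support: "i \<in> {1..k} \<Longrightarrow> v i \<in> support_set (T i)"
    and disjoint: "disjoint_family_on (\<lambda>i. pverts (T i)) {1..k}"
    and new: "w \<notin> (\<Union>i\<in>{1..k}. pverts (T i))"
begin

definition J :: "'a pair_pre_digraph" where "J = SL_join k T v w"

lemma pair: "i \<in> {1..k} \<Longrightarrow> pair_graph (T i)"
  using proper by (simp add: proper_graph_def)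

lemma pverts_J: "pverts J = insert w (\<Union>i\<in>{1..k}. pverts (T i))"
  by (simp add: J_def SL_join_def)

lemma parcs_J: "parcs J = (\<Union>i\<in>{1..k}. parcs (T i) \<union> {(v i, w), (w, v i)})"
  by (simp add: J_def SL_join_def)

lemma v_in: "i \<in> {1..k} \<Longrightarrow> v i \<in> pverts (T i)"
  using support by (simp add: support_set_def)

lemma new': "i \<in> {1..k} \<Longrightarrow> x \<in> pverts (T i) \<Longrightarrow> x \<noteq> w"
  using new by blast

lemma same_index: "i \<in> {1..k} \<Longrightarrow> j \<in> {1..k} \<Longrightarrow> x \<in> pverts (T i) \<Longrightarrow> x \<in> pverts (T j) \<Longrightarrow> i = j"
  using disjoint unfolding disjoint_family_on_def by blast

lemma eq_UN_parts:
  assumes A: "A \<subseteq> pverts J" "w \<notin> A"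
    and iff: "\<And>i x. i \<in> {1..k} \<Longrightarrow> x \<in> pverts (T i) \<Longrightarrow> x \<in> A \<longleftrightarrow> x \<in> B i"
    and B: "\<And>i. B i \<subseteq> pverts (T i)"
  shows "A = (\<Union>i\<in>{1..k}. B i)"
proof (intro equalityI subsetI)
  fix x assume x: "x \<in> A"
  then obtain i where "i \<in> {1..k}" "x \<in> pverts (T i)"
    using A unfolding pverts_J by blast
  then show "x \<in> (\<Union>i\<in>{1..k}. B i)" using iff x by blast
next
  fix x assume "x \<in> (\<Union>i\<in>{1..k}. B i)"
  then obtain i where "i \<in> {1..k}" "x \<in> B i" by blast
  then show "x \<in> A" using iff B[of i] by blast
qed

lemma nbhd_w: "nbhd J w = v ` {1..k}"
proof -
  have "(w, y) \<notin> parcs (T i)" "v i \<noteq> w" if "i \<in> {1..k}" for i y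
    using pair_graphD(2)[OF pair] new' v_in that by blast+
  then have "(w, y) \<in> parcs J \<longleftrightarrow> y \<in> v ` {1..k}" for y
    unfolding parcs_J by auto
  then show ?thesis by auto
qed

lemma nbhd_J:
  assumes "i \<in> {1..k}" "x \<in> pverts (T i)"
  shows "nbhd J x = nbhd (T i) x \<union> (if x = v i then {w} else {})"
proof -
  have "(x, y) \<in> parcs J \<longleftrightarrow> (x, y) \<in> parcs (T i) \<or> x = v i \<and> y = w" for y
  proof
    assume "(x, y) \<in> parcs J"
    then obtain j where j: "j \<in> {1..k}" "(x, y) \<in> parcs (T j) \<or> x = v j \<and> y = w"
      using new'[OF assms] by (auto simp: parcs_J)
    then have "x \<in> pverts (T j)" using pair_graphD(2)[OF pair] v_in by blast
    then have "j = i" using same_index assms j by blast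
    then show "(x, y) \<in> parcs (T i) \<or> x = v i \<and> y = w" using j by simp
  qed (use assms in \<open>auto simp: parcs_J\<close>)
  then show ?thesis by auto
qed

lemma nbhd_J_outside: "i \<in> {1..k} \<Longrightarrow> x \<in> pverts (T i) \<Longrightarrow> x \<noteq> v i \<Longrightarrow> nbhd J x = nbhd (T i) x"
  using nbhd_J by simp

lemma nbhd_J_subset: "i \<in> {1..k} \<Longrightarrow> nbhd (T i) x \<subseteq> pverts (T i)"
  using pair_graphD(3)[OF pair] by auto

lemma card_nbhd_w: "card (nbhd J w) = k"
proof -
  have "inj_on v {1..k}" using same_index v_in by (metis inj_onI)
  then show ?thesis by (simp add: nbhd_w card_image)
qed

text \<open>The attached vertex keeps a neighbour in its own piece and gains \<open>w\<close>, so it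
  is never a leaf of the join.\<close>

lemma card_nbhd_v:
  assumes i: "i \<in> {1..k}"
  shows "2 \<le> card (nbhd J (v i))"
proof -
  have "w \<notin> nbhd (T i) (v i)" "nbhd (T i) (v i) \<noteq> {}"
    using nbhd_J_subset[OF i] new'[OF i] proper[OF i] v_in[OF i] unfolding proper_graph_def by blast+
  moreover have "finite (nbhd (T i) (v i))" by (rule pair_graphD(6)[OF pair[OF i]])
  ultimately show ?thesis
    using nbhd_J[OF i v_in[OF i]] by (simp add: card_gt_0_iff Suc_le_eq)
qed

lemma card_nbhd_J_1:
  assumes "i \<in> {1..k}" "x \<in> pverts (T i)"
  shows "card (nbhd J x) = 1 \<longleftrightarrow> x \<noteq> v i \<and> card (nbhd (T i) x) = 1"
  using card_nbhd_v[OF assms(1)] nbhd_J_outside[OF assms] by (cases "x = v i") auto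

section \<open>Leaves, supports and support links of a join\<close>

definition L :: "nat \<Rightarrow> 'a set" where "L i = leaf_set (T i) - {v i}"

definition R :: "nat \<Rightarrow> 'a set" where
  "R i = {x \<in> pverts (T i). x = v i \<or> (\<exists>u\<in>nbhd (T i) x. u \<noteq> v i \<and> card (nbhd (T i) u) = 1)}"

lemma LR_subset: "L i \<subseteq> pverts (T i)" "R i \<subseteq> pverts (T i)" "link_set (T i) \<subseteq> pverts (T i)"
  by (auto simp: L_def R_def leaf_set_def link_set_def)

lemma leaf_set_J: "leaf_set J = (\<Union>i\<in>{1..k}. L i)"
  using card_nbhd_w two_le card_nbhd_J_1 by (auto simp: leaf_set_def L_def pverts_J)

lemma support_set_J_iff:
  assumes i: "i \<in> {1..k}" and x: "x \<in> pverts (T i)"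
  shows "x \<in> support_set J \<longleftrightarrow> x \<in> R i"
proof -
  have leaf: "card (nbhd J u) = 1 \<longleftrightarrow> u \<noteq> v i \<and> card (nbhd (T i) u) = 1" if "u \<in> nbhd (T i) x" for u
    using card_nbhd_J_1[OF i] nbhd_J_subset[OF i] that by blast
  show ?thesis
  proof (cases "x = v i")
    case True
    obtain l where "l \<in> nbhd (T i) x" "card (nbhd (T i) l) = 1"
      using support[OF i] True by (auto simp: support_set_def)
    moreover have "l \<noteq> x" using \<open>l \<in> nbhd (T i) x\<close> pair_graphD(5)[OF pair[OF i]] by auto
    ultimately have "\<exists>u\<in>nbhd J x. card (nbhd J u) = 1"
      using leaf nbhd_J[OF i x] True by blast
    then show ?thesis using True x i by (auto simp: support_set_def R_def pverts_J)
  next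
    case False
    then show ?thesis
      using leaf nbhd_J_outside[OF i x] x i by (auto simp: support_set_def R_def pverts_J simp del: mem_nbhd)
  qed
qed

lemma w_not_support: "w \<notin> support_set J"
proof
  assume "w \<in> support_set J"
  then obtain i where "i \<in> {1..k}" "card (nbhd J (v i)) = 1"
    by (auto simp: support_set_def nbhd_w simp del: mem_nbhd)
  then show False using card_nbhd_v[of i] by simp
qed

lemma support_set_J: "support_set J = (\<Union>i\<in>{1..k}. R i)"
  by (rule eq_UN_parts) (use w_not_support support_set_J_iff LR_subset(2) in \<open>auto simp: support_set_def\<close>)

lemma v_in_R: "i \<in> {1..k} \<Longrightarrow> v i \<in> R i"
  using v_in by (simp add: R_def)

text \<open>The neighbours \<open>v i\<close> of \<open>w\<close> are supports but not leaves, and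
  there are at least two, so \<open>w\<close> is a link. The only old vertices with a new neighbour
  are the \<open>v i\<close>, and being supports they are links neither before nor after.\<close>

lemma link_set_J: "link_set J = insert w (\<Union>i\<in>{1..k}. link_set (T i))"
proof -
  have "w \<in> link_set J"
    unfolding link_set_def
    using card_nbhd_w two_le w_not_support v_in_R
    by (auto simp: leaf_set_def pverts_J support_set_J nbhd_w simp del: mem_nbhd)
  moreover have "x \<in> link_set J \<longleftrightarrow> x \<in> link_set (T i)" if i: "i \<in> {1..k}" and x: "x \<in> pverts (T i)" for i x
  proof -
    have "x \<in> leaf_set J \<longleftrightarrow> x \<in> L i"
      using i x same_index LR_subset(1) unfolding leaf_set_J by blast
    moreover have "nbhd J x \<subseteq> support_set J \<longleftrightarrow> nbhd (T i) x \<subseteq> R i" if "x \<noteq> v i"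
      using support_set_J_iff[OF i] nbhd_J_subset[OF i] nbhd_J_outside[OF i x that] by blast
    ultimately have "x \<in> link_set J \<longleftrightarrow> x \<in> pverts (T i) \<and> x \<notin> L i \<and> x \<notin> R i \<and> nbhd (T i) x \<subseteq> R i"
      using support_set_J_iff[OF i x] v_in_R[OF i] i x by (auto simp: link_set_def pverts_J simp del: mem_nbhd)
    then show ?thesis
      using proper_graph_support(2)[OF proper[OF i] support[OF i]] unfolding L_def R_def by blast
  qed
  then have "link_set J - {w} = (\<Union>i\<in>{1..k}. link_set (T i))"
    using new' LR_subset(3) by (intro eq_UN_parts) (auto simp: link_set_def)
  ultimately show ?thesis by auto
qed

section \<open>Additivity of both sides of the equation\<close>

lemma card_UN_parts:
  assumes "\<And>i. A i \<subseteq> pverts (T i)"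
  shows "card (\<Union>i\<in>{1..k}. A i) = (\<Sum>i\<in>{1..k}. card (A i))"
proof (rule card_UN_disjoint)
  show "\<forall>i\<in>{1..k}. finite (A i)"
    using finite_subset[OF assms pair_graphD(1)[OF pair]] by blast
  show "\<forall>i\<in>{1..k}. \<forall>j\<in>{1..k}. i \<noteq> j \<longrightarrow> A i \<inter> A j = {}"
    using assms same_index by blast
qed simp

lemma finite_UN_parts:
  assumes "\<And>i. A i \<subseteq> pverts (T i)"
  shows "finite (\<Union>i\<in>{1..k}. A i)"
  using finite_subset[OF assms pair_graphD(1)[OF pair]] by blast

text \<open>The new vertex \<open>w\<close> adds one to the number of vertices and one to the number
  of support links, and these cancel.\<close>

lemma ld_value_J: "ld_value J = (\<Sum>i\<in>{1..k}. ld_value (T i))"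
proof -
  have "card (pverts J) = Suc (\<Sum>i\<in>{1..k}. card (pverts (T i)))"
    unfolding pverts_J using new card_UN_parts[of "\<lambda>i. pverts (T i)"] finite_UN_parts[of "\<lambda>i. pverts (T i)"]
    by simp
  moreover have "w \<notin> (\<Union>i\<in>{1..k}. link_set (T i))"
    using new LR_subset(3) by blast
  then have "card (link_set J) = Suc (\<Sum>i\<in>{1..k}. card (link_set (T i)))"
    unfolding link_set_J using card_UN_parts[OF LR_subset(3)] finite_UN_parts[OF LR_subset(3)] by simp
  moreover have "card (leaf_set J) = (\<Sum>i\<in>{1..k}. card (L i))"
    unfolding leaf_set_J by (rule card_UN_parts[OF LR_subset(1)])
  moreover have "card (support_set J) = (\<Sum>i\<in>{1..k}. card (R i))"
    unfolding support_set_J by (rule card_UN_parts[OF LR_subset(2)])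
  moreover have "(\<Sum>i\<in>{1..k}. real (card (L i)) - real (card (R i))) =
      (\<Sum>i\<in>{1..k}. real (card (leaf_set (T i))) - real (card (support_set (T i))))"
    using proper_graph_support(1)[OF proper support] unfolding L_def R_def by (intro sum.cong) auto
  ultimately show ?thesis
    unfolding ld_value_def
    by (simp add: sum_divide_distrib[symmetric] sum_subtractf sum.distrib)
qed

text \<open>Take the union of optimal sets that contain the attached vertices. Vertices outside it
  keep their traces, and \<open>w\<close> is dominated by all \<open>v i\<close>; as
  \<open>2 \<le> k\<close>, its trace meets two pieces and differs from every trace inside one
  piece.\<close>

lemma gamma_LD_J_le: "gamma_LD J \<le> (\<Sum>i\<in>{1..k}. gamma_LD (T i))"
proof -
  have "\<exists>S. locating_dominating (T i) S \<and> v i \<in> S \<and> card S = gamma_LD (T i)" if i: "i \<in> {1..k}" for i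
  proof -
    obtain S where S: "locating_dominating (T i) S" "card S = gamma_LD (T i)"
      by (rule gamma_LD_attained)
    obtain S' where "locating_dominating (T i) S'" "v i \<in> S'" "card S' = card S"
      by (rule locating_dominating_exchange[OF pair[OF i] support[OF i] locating_dominatingD(1)[OF S(1)]])
        (use locating_dominatingD(2,3)[OF S(1)] in auto)
    then show ?thesis using S(2) by auto
  qed
  then obtain S where S: "\<And>i. i \<in> {1..k} \<Longrightarrow>
      locating_dominating (T i) (S i) \<and> v i \<in> S i \<and> card (S i) = gamma_LD (T i)"
    by metis
  define U where "U = (\<Union>i\<in>{1..k}. S i)"
  have sub: "S i \<subseteq> pverts (T i)" if "i \<in> {1..k}" for i
    using S that locating_dominatingD(1) by blast
  have U_part: "U \<inter> pverts (T i) = S i" if "i \<in> {1..k}" for i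
    using that sub same_index unfolding U_def by blast
  have nb: "nbhd J x \<inter> U = nbhd (T i) x \<inter> S i" if "i \<in> {1..k}" "x \<in> pverts (T i)" "x \<notin> S i" for i x
  proof -
    have "nbhd J x = nbhd (T i) x" using nbhd_J_outside that S by blast
    then show ?thesis using U_part[OF that(1)] nbhd_J_subset[OF that(1), of x] by blast
  qed
  have nb_w: "nbhd J w \<inter> U = v ` {1..k}"
    using nbhd_w S unfolding U_def by blast
  have loc_w: False if i: "i \<in> {1..k}" and "nbhd (T i) x \<inter> S i = v ` {1..k}" for i x
  proof -
    \<comment> \<open>Any index other than \<open>i\<close> would do; it exists because
      \<open>2 \<le> k\<close>.\<close>
    define j where "j = (if i = 1 then 2 else 1 :: nat)"
    have j: "j \<in> {1..k}" "j \<noteq> i" using two_le by (auto simp: j_def)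
    then have "v j \<in> S i" using that by blast
    then show False using sub[OF i] v_in[OF j(1)] same_index[OF i j(1)] j(2) by blast
  qed
  have "locating_dominating J U"
  proof (rule locating_dominatingI)
    show "U \<subseteq> pverts J" using sub by (fastforce simp: U_def pverts_J)
  next
    fix x assume x: "x \<in> pverts J" "x \<notin> U"
    show "nbhd J x \<inter> U \<noteq> {}"
    proof (cases "x = w")
      case True
      then show ?thesis using nb_w two_le by simp
    next
      case False
      then obtain i where i: "i \<in> {1..k}" "x \<in> pverts (T i)" "x \<notin> S i"
        using x by (auto simp: pverts_J U_def)
      then show ?thesis using nb[OF i] S[OF i(1)] locating_dominatingD(2) by metis
    qed
  next
    fix x y assume x: "x \<in> pverts J" "x \<notin> U" and y: "y \<in> pverts J" "y \<notin> U"
      and eq: "nbhd J x \<inter> U = nbhd J y \<inter> U"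
    have part: "\<exists>i. i \<in> {1..k} \<and> z \<in> pverts (T i) \<and> z \<notin> S i" if "z \<in> pverts J" "z \<notin> U" "z \<noteq> w" for z
      using that by (auto simp: pverts_J U_def)
    consider "x = w" "y = w" | "x = w" "y \<noteq> w" | "x \<noteq> w" "y = w" | "x \<noteq> w" "y \<noteq> w" by blast
    then show "x = y"
    proof cases
      case 2
      then obtain i where "i \<in> {1..k}" "y \<in> pverts (T i)" "y \<notin> S i" using part y by blast
      then show ?thesis using loc_w nb nb_w eq 2 by metis
    next
      case 3
      then obtain i where "i \<in> {1..k}" "x \<in> pverts (T i)" "x \<notin> S i" using part x by blast
      then show ?thesis using loc_w nb nb_w eq 3 by metis
    next
      case 4
      obtain i where i: "i \<in> {1..k}" "x \<in> pverts (T i)" "x \<notin> S i" using part x 4 by blast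
      obtain j where j: "j \<in> {1..k}" "y \<in> pverts (T j)" "y \<notin> S j" using part y 4 by blast
      have eq': "nbhd (T i) x \<inter> S i = nbhd (T j) y \<inter> S j" using eq nb[OF i] nb[OF j] by simp
      moreover have "nbhd (T i) x \<inter> S i \<noteq> {}"
        using locating_dominatingD(2) S[OF i(1)] i by metis
      ultimately have "i = j" using sub[OF i(1)] sub[OF j(1)] same_index[OF i(1) j(1)] by blast
      then show ?thesis using locating_dominatingD(3) S[OF i(1)] i j eq' by metis
    qed simp
  qed
  then have "gamma_LD J \<le> card U" by (rule gamma_LD_le)
  also have "\<dots> \<le> (\<Sum>i\<in>{1..k}. card (S i))"
    unfolding U_def by (intro card_UN_le) simp
  also have "\<dots> = (\<Sum>i\<in>{1..k}. gamma_LD (T i))"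
    using S by (intro sum.cong) auto
  finally show ?thesis .
qed

text \<open>Restricting an optimal set of the join to a piece preserves all traces except possibly
  that of \<open>v i\<close>, which may have relied on \<open>w\<close>. This single exception is
  what \<open>locating_dominating_exchange\<close> tolerates.\<close>

lemma gamma_LD_J_ge: "(\<Sum>i\<in>{1..k}. gamma_LD (T i)) \<le> gamma_LD J"
proof -
  obtain S where S: "locating_dominating J S" "card S = gamma_LD J"
    by (rule gamma_LD_attained)
  have "finite (pverts J)"
    using finite_UN_parts[of "\<lambda>i. pverts (T i)"] by (simp add: pverts_J)
  then have finS: "finite S" using finite_subset[OF locating_dominatingD(1)[OF S(1)]] by blast
  have "gamma_LD (T i) \<le> card (S \<inter> pverts (T i))" if i: "i \<in> {1..k}" for i
  proof -
    let ?S = "S \<inter> pverts (T i)"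
    have nb: "nbhd (T i) x \<inter> ?S = nbhd J x \<inter> S" if "x \<in> pverts (T i)" "x \<noteq> v i" for x
      using nbhd_J_outside[OF i that] nbhd_J_subset[OF i, of x] by blast
    have inJ: "x \<in> pverts J" if "x \<in> pverts (T i)" for x
      using i that by (auto simp: pverts_J)
    obtain S' where "locating_dominating (T i) S'" "card S' = card ?S"
    proof (rule locating_dominating_exchange[OF pair[OF i] support[OF i]])
      show "?S \<subseteq> pverts (T i)" by blast
    next
      fix u assume "u \<in> pverts (T i)" "u \<notin> ?S" "u \<noteq> v i"
      then show "nbhd (T i) u \<inter> ?S \<noteq> {}"
        using nb locating_dominatingD(2)[OF S(1)] inJ by (metis IntI)
    next
      fix u x assume "u \<in> pverts (T i)" "u \<notin> ?S" "u \<noteq> v i" "x \<in> pverts (T i)" "x \<notin> ?S" "x \<noteq> v i"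
        "nbhd (T i) u \<inter> ?S = nbhd (T i) x \<inter> ?S"
      then show "u = x"
        using nb locating_dominatingD(3)[OF S(1)] inJ by (metis IntI)
    qed blast
    then show ?thesis using gamma_LD_le by metis
  qed
  then have "(\<Sum>i\<in>{1..k}. gamma_LD (T i)) \<le> (\<Sum>i\<in>{1..k}. card (S \<inter> pverts (T i)))"
    by (rule sum_mono)
  also have "\<dots> = card (\<Union>i\<in>{1..k}. S \<inter> pverts (T i))"
    using card_UN_parts[of "\<lambda>i. S \<inter> pverts (T i)"] by simp
  also have "\<dots> \<le> card S"
    using finS by (intro card_mono) auto
  finally show ?thesis using S(2) by simp
qed

lemma gamma_LD_J: "gamma_LD J = (\<Sum>i\<in>{1..k}. gamma_LD (T i))"
  using gamma_LD_J_le gamma_LD_J_ge by (rule le_antisym)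

text \<open>Adjacent leaves of the join would be adjacent leaves of one piece, hence all of it; but
  that piece also contains \<open>v i\<close>, which is not a leaf of the join.\<close>

lemma proper_graph_J: "proper_graph J"
  unfolding proper_graph_def
proof (intro conjI ballI allI impI)
  have "finite (pverts J)"
    using finite_UN_parts[of "\<lambda>i. pverts (T i)"] by (simp add: pverts_J)
  moreover have "parcs J \<subseteq> pverts J \<times> pverts J"
    using pair_graphD(2,3)[OF pair] v_in by (fastforce simp: pverts_J parcs_J)
  moreover have "sym (parcs J)"
    unfolding parcs_J sym_def using pair_graphD(4)[OF pair] by blast
  moreover have "irrefl (parcs J)"
    unfolding parcs_J irrefl_def using pair_graphD(5)[OF pair] new' v_in by blast
  ultimately show "pair_graph J" by (simp add: pair_graph_iff)
next
  fix x assume "x \<in> pverts J"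
  then consider "x = w" | i where "i \<in> {1..k}" "x \<in> pverts (T i)" by (auto simp: pverts_J)
  then show "nbhd J x \<noteq> {}"
  proof cases
    case 1
    then show ?thesis using nbhd_w two_le by simp
  next
    case 2
    then show ?thesis using nbhd_J[OF 2] proper[OF 2(1)] unfolding proper_graph_def by blast
  qed
next
  fix x y assume xy: "(x, y) \<in> parcs J" "card (nbhd J x) = 1" "card (nbhd J y) = 1"
  then have "x \<noteq> w" "y \<noteq> w" using card_nbhd_w two_le by auto
  then obtain i where i: "i \<in> {1..k}" "(x, y) \<in> parcs (T i)"
    using xy(1) unfolding parcs_J by blast
  then have "x \<in> pverts (T i)" "y \<in> pverts (T i)" using pair_graphD(2,3)[OF pair] by blast+
  then have *: "x \<noteq> v i" "card (nbhd (T i) x) = 1" "y \<noteq> v i" "card (nbhd (T i) y) = 1"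
    using xy card_nbhd_J_1[OF i(1)] by blast+
  then have "pverts (T i) = {x, y}"
    using proper[OF i(1)] i(2) by (simp add: proper_graph_def)
  then show "pverts J = {x, y}" using * v_in[OF i(1)] by auto
qed

end

section \<open>Splitting a tree at a support link\<close>

text \<open>The pieces are the components of the tree without \<open>w\<close> that contain a
  neighbour of \<open>w\<close>. They are disjoint because a path from \<open>v i\<close> to
  \<open>v j\<close> avoiding \<open>w\<close>, followed by the edge to \<open>w\<close>, would
  bypass the bridge between \<open>v i\<close> and \<open>w\<close>. They cover the rest by
  connectedness.\<close>

lemma tree_split_at_link:
  assumes G: "undirected_tree G" and n: "card (pverts G) \<noteq> 1" and w: "w \<in> link_set G"
  obtains k T v where "support_join k T v w" "G = SL_join k T v w"
    "\<And>i. i \<in> {1..k} \<Longrightarrow> undirected_tree (T i)"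
    "\<And>i. i \<in> {1..k} \<Longrightarrow> card (pverts (T i)) < card (pverts G)"
    "\<And>i. i \<in> {1..k} \<Longrightarrow> card (pverts (T i)) \<noteq> 1"
proof -
  note P = pair_graphD[OF undirected_treeD(1)[OF G]]
  have symE: "sym (parcs G)" using undirected_treeD(1)[OF G] by (simp add: pair_graph_iff)
  have wV: "w \<in> pverts G" and w_leaf: "w \<notin> leaf_set G" and w_nbhd: "nbhd G w \<subseteq> support_set G"
    using w by (auto simp: link_set_def)
  define k where "k = card (nbhd G w)"
  obtain v where v: "bij_betw v {1..k} (nbhd G w)"
    using ex_bij_betw_nat_finite_1[OF P(6)] unfolding k_def by blast
  then have v_img: "v ` {1..k} = nbhd G w" by (rule bij_betw_imp_surj_on)
  have v_nbhd: "v i \<in> nbhd G w" if "i \<in> {1..k}" for i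
    unfolding v_img[symmetric] using that by (rule imageI)
  then have v_arc: "(v i, w) \<in> parcs G" if "i \<in> {1..k}" for i
    using P(4) that by simp
  have k: "2 \<le> k"
  proof -
    have "nbhd G w \<noteq> {}"
      using undirected_tree_proper[OF G n] wV by (simp add: proper_graph_def)
    then have "card (nbhd G w) \<noteq> 0" using P(6) by simp
    moreover have "card (nbhd G w) \<noteq> 1" using w_leaf wV by (simp add: leaf_set_def)
    ultimately show ?thesis by (simp add: k_def)
  qed
  define F where "F = parcs G \<inter> {(x, y). x \<noteq> w \<and> y \<noteq> w}"
  have symF: "sym F" using symE by (auto simp: F_def sym_def)
  \<comment> \<open>\<open>F\<close> is the edge set without \<open>w\<close>, so \<open>V i\<close>
    is the component of the i-th neighbour after deleting \<open>w\<close>.\<close>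
  define V where "V = (\<lambda>i. {x. (v i, x) \<in> F\<^sup>*})"
  define T where "T = (\<lambda>i. \<lparr>pverts = V i, parcs = F \<inter> V i \<times> V i\<rparr>)"
  have V_step: "y \<in> V i" if "x \<in> V i" "(x, y) \<in> F" for x y i
    using that by (simp add: V_def)
  have vV: "v i \<in> V i" for i by (simp add: V_def)
  have V_sub: "x \<in> pverts G - {w}" if i: "i \<in> {1..k}" and x: "x \<in> V i" for x i
  proof -
    have "(v i, x) \<in> F\<^sup>*" using x by (simp add: V_def)
    then show ?thesis
    proof induction
      case base
      then show ?case using P(2,5) v_arc[OF i] by blast
    next
      case (step y z)
      then show ?case using P(3) by (auto simp: F_def)
    qed
  qed
  have disj: "V i \<inter> V j = {}" if ij: "i \<in> {1..k}" "j \<in> {1..k}" "i \<noteq> j" for i j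
  proof (rule ccontr)
    assume "V i \<inter> V j \<noteq> {}"
    then obtain x where "(v i, x) \<in> F\<^sup>*" "(v j, x) \<in> F\<^sup>*" by (auto simp: V_def)
    then have vv: "(v i, v j) \<in> F\<^sup>*" using symD[OF sym_rtrancl[OF symF]] rtrancl_trans by metis
    have mono: "F\<^sup>* \<subseteq> (parcs G - {(v i, w), (w, v i)})\<^sup>*"
      by (rule rtrancl_mono) (auto simp: F_def)
    have "v i \<noteq> v j" using inj_onD[OF bij_betw_imp_inj_on[OF v]] ij by blast
    then have "(v j, w) \<in> parcs G - {(v i, w), (w, v i)}"
      using v_arc[OF ij(2)] P(5) by auto
    then have "(v i, w) \<in> (parcs G - {(v i, w), (w, v i)})\<^sup>*"
      by (rule rtrancl_into_rtrancl[OF subsetD[OF mono vv]])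
    then show False using bridgedD[OF undirected_treeD(3)[OF G] v_arc[OF ij(1)]] by simp
  qed
  have cover: "x = w \<or> (\<exists>i\<in>{1..k}. x \<in> V i)" if "x \<in> pverts G" for x
  proof -
    have "(w, x) \<in> (parcs G)\<^sup>*" using undirected_treeD(4)[OF G wV that] .
    then show ?thesis
    proof induction
      case (step y z)
      consider "z = w" | "z \<noteq> w" "y = w" | "z \<noteq> w" "y \<noteq> w" by blast
      then show ?case
      proof cases
        case 2
        then have "z \<in> v ` {1..k}" using step unfolding v_img by simp
        then show ?thesis using vV by blast
      next
        case 3
        then have "(y, z) \<in> F" using step by (simp add: F_def)
        then show ?thesis using 3 step V_step by blast
      qed simp
    qed simp
  qed
  have tree: "undirected_tree (T i)" if i: "i \<in> {1..k}" for i
  proof (rule undirected_tree_subgraph[OF G])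
    have "finite (V i)" using V_sub[OF i] finite_subset[OF _ P(1), of "V i"] by blast
    then show "pair_graph (T i)"
      using symF P(5) by (auto simp: T_def pair_graph_iff sym_def irrefl_def F_def)
    show "pverts (T i) \<subseteq> pverts G" "parcs (T i) \<subseteq> parcs G" "pverts (T i) \<noteq> {}"
      using V_sub[OF i] vV by (auto simp: T_def F_def)
    have sym: "sym (parcs (T i))" using symF by (auto simp: T_def sym_def)
    have root: "(v i, x) \<in> (parcs (T i))\<^sup>*" if "x \<in> V i" for x
    proof -
      have "(v i, x) \<in> F\<^sup>*" using that by (simp add: V_def)
      then show ?thesis
      proof induction
        case (step y z)
        then have "(y, z) \<in> parcs (T i)"
          using V_step by (auto simp: T_def V_def)
        then show ?case using step by simp
      qed simp
    qed
    fix x y assume "x \<in> pverts (T i)" "y \<in> pverts (T i)"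
    then have "(v i, x) \<in> (parcs (T i))\<^sup>*" "(v i, y) \<in> (parcs (T i))\<^sup>*"
      using root by (simp_all add: T_def)
    then show "(x, y) \<in> (parcs (T i))\<^sup>*"
      using symD[OF sym_rtrancl[OF sym]] rtrancl_trans by metis
  qed
  have leaf: "\<exists>l\<in>nbhd (T i) (v i). l \<noteq> v i \<and> card (nbhd (T i) l) = 1" if i: "i \<in> {1..k}" for i
  proof -
    have "v i \<in> support_set G" using v_nbhd[OF i] w_nbhd by blast
    then obtain l where l: "(v i, l) \<in> parcs G" "card (nbhd G l) = 1"
      by (auto simp: support_set_def)
    \<comment> \<open>A link is not a leaf, so the leaf that makes \<open>v i\<close> a support
      survives the deletion of \<open>w\<close> and lies in the same piece.\<close>
    have "l \<noteq> w" using l(2) w_leaf wV by (auto simp: leaf_set_def)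
    moreover have "v i \<noteq> w" "v i \<noteq> l" using v_arc[OF i] l(1) P(5) by auto
    ultimately have vl: "(v i, l) \<in> F" using l(1) by (simp add: F_def)
    then have arcs: "(v i, l) \<in> parcs (T i)" "(l, v i) \<in> parcs (T i)"
      using V_step[OF vV vl] vV symD[OF symF vl] by (auto simp: T_def)
    moreover have "nbhd (T i) l \<subseteq> nbhd G l" by (auto simp: T_def F_def)
    moreover have "nbhd G l = {v i}"
      using l P(4)[OF l(1)] by (metis card_1_singletonE mem_nbhd singletonD)
    ultimately have "nbhd (T i) l = {v i}" by auto
    then show ?thesis
      using arcs(1) \<open>v i \<noteq> l\<close> by (intro bexI[of _ l]) auto
  qed
  have n1: "card (pverts (T i)) \<noteq> 1" if i: "i \<in> {1..k}" for i
  proof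
    assume "card (pverts (T i)) = 1"
    then obtain x where "pverts (T i) = {x}" by (rule card_1_singletonE)
    moreover obtain l where "(v i, l) \<in> parcs (T i)" "l \<noteq> v i" using leaf[OF i] by auto
    ultimately show False
      using pair_graphD(2,3)[OF undirected_treeD(1)[OF tree[OF i]]] by (metis singletonD)
  qed
  have "support_join k T v w"
  proof
    show "2 \<le> k" by (rule k)
    show "proper_graph (T i)" if "i \<in> {1..k}" for i
      using undirected_tree_proper[OF tree n1] that by blast
    show "v i \<in> support_set (T i)" if "i \<in> {1..k}" for i
      using leaf[OF that] vV by (auto simp: support_set_def T_def)
    show "disjoint_family_on (\<lambda>i. pverts (T i)) {1..k}"
      using disj by (simp add: disjoint_family_on_def T_def)
    show "w \<notin> (\<Union>i\<in>{1..k}. pverts (T i))"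
      using V_sub unfolding T_def by fastforce
  qed
  moreover have "G = SL_join k T v w"
  proof -
    have "pverts G = insert w (\<Union>i\<in>{1..k}. V i)"
      using cover V_sub wV by auto
    moreover have "(x, y) \<in> parcs G \<longleftrightarrow>
        (\<exists>i\<in>{1..k}. (x, y) \<in> F \<inter> V i \<times> V i \<or> x = v i \<and> y = w \<or> x = w \<and> y = v i)" for x y
    proof
      assume xy: "(x, y) \<in> parcs G"
      consider "x = w" | "y = w" | "x \<noteq> w" "y \<noteq> w" by blast
      then show "\<exists>i\<in>{1..k}. (x, y) \<in> F \<inter> V i \<times> V i \<or> x = v i \<and> y = w \<or> x = w \<and> y = v i"
      proof cases
        case 1
        then have "y \<in> v ` {1..k}" using xy unfolding v_img by simp
        then show ?thesis using 1 by blast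
      next
        case 2
        then have "x \<in> v ` {1..k}" using P(4)[OF xy] unfolding v_img by simp
        then show ?thesis using 2 by blast
      next
        case 3
        then obtain i where "i \<in> {1..k}" "x \<in> V i" using cover P(2)[OF xy] by blast
        moreover have "(x, y) \<in> F" using 3 xy by (simp add: F_def)
        ultimately show ?thesis using V_step by blast
      qed
    next
      assume "\<exists>i\<in>{1..k}. (x, y) \<in> F \<inter> V i \<times> V i \<or> x = v i \<and> y = w \<or> x = w \<and> y = v i"
      then show "(x, y) \<in> parcs G"
        using v_arc P(4) unfolding F_def by blast
    qed
    then have "parcs G = (\<Union>i\<in>{1..k}. (F \<inter> V i \<times> V i) \<union> {(v i, w), (w, v i)})"
      by auto
    ultimately show ?thesis by (simp add: SL_join_def T_def)
  qed
  moreover have "card (pverts (T i)) < card (pverts G)" if "i \<in> {1..k}" for i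
    using V_sub[OF that] wV P(1) by (intro psubset_card_mono) (auto simp: T_def)
  ultimately show ?thesis using that tree n1 by blast
qed

lemma gamma_LD_le_ld_value:
  assumes "undirected_tree T" "card (pverts T) \<noteq> 1"
  shows "real (gamma_LD T) \<le> ld_value T"
  using assms
proof (induction "card (pverts T)" arbitrary: T rule: less_induct)
  case less
  show ?case
  proof (cases "link_set T = {}")
    case True
    then show ?thesis using gamma_LD_leaf_support_bound[OF less.prems] by (simp add: ld_value_def)
  next
    case False
    then obtain w where "w \<in> link_set T" by blast
    then obtain k P v where split: "support_join k P v w" "T = SL_join k P v w"
      and P: "\<And>i. i \<in> {1..k} \<Longrightarrow> undirected_tree (P i)"
        "\<And>i. i \<in> {1..k} \<Longrightarrow> card (pverts (P i)) < card (pverts T)"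
        "\<And>i. i \<in> {1..k} \<Longrightarrow> card (pverts (P i)) \<noteq> 1"
      using tree_split_at_link[OF less.prems] by metis
    interpret support_join k P v w by fact
    have "real (gamma_LD (P i)) \<le> ld_value (P i)" if "i \<in> {1..k}" for i
      using less.hyps P that by blast
    then have "(\<Sum>i\<in>{1..k}. real (gamma_LD (P i))) \<le> (\<Sum>i\<in>{1..k}. ld_value (P i))"
      by (rule sum_mono)
    then show ?thesis
      using gamma_LD_J ld_value_J split(2) by (simp add: J_def)
  qed
qed

section \<open>Isomorphic graphs\<close>

definition map_graph :: "('a \<Rightarrow> 'b) \<Rightarrow> 'a pair_pre_digraph \<Rightarrow> 'b pair_pre_digraph" where
  "map_graph f G = \<lparr>pverts = f ` pverts G, parcs = map_prod f f ` parcs G\<rparr>"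

text \<open>The library's isomorphisms carry a separate arc map. Arcs of pair digraphs are the pairs
  of their ends, so compatibility with tails and heads determines the arc map from the vertex
  map.\<close>

lemma digraph_iso_imp_map_graph:
  assumes "digraph_iso (with_proj G) (with_proj H)"
  obtains f where "inj_on f (pverts G)" "H = map_graph f G"
proof -
  obtain h where h: "pre_digraph.digraph_isomorphism (with_proj G) h"
    and H: "with_proj H = app_iso h (with_proj G)"
    using assms by (auto simp: digraph_iso_def)
  let ?f = "iso_verts h"
  have inj: "inj_on ?f (pverts G)"
    and ends: "\<And>a. a \<in> parcs G \<Longrightarrow> ?f (fst a) = iso_tail h (iso_arcs h a) \<and> ?f (snd a) = iso_head h (iso_arcs h a)"
    using h by (auto simp: pre_digraph.digraph_isomorphism_def)
  have fields: "pverts H = ?f ` pverts G" "parcs H = iso_arcs h ` parcs G" "fst = iso_tail h" "snd = iso_head h"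
    using H by (simp_all add: app_iso_def with_proj_def)
  have "iso_arcs h a = map_prod ?f ?f a" if "a \<in> parcs G" for a
    using ends[OF that] unfolding fields(3,4)[symmetric] by (simp add: prod_eq_iff)
  then have "parcs H = map_prod ?f ?f ` parcs G" using fields(2) by simp
  then have "H = map_graph ?f G" using fields(1) by (simp add: map_graph_def)
  with inj show ?thesis by (rule that)
qed

lemma digraph_iso_map_graph:
  assumes "pair_graph G" "inj_on f (pverts G)"
  shows "digraph_iso (with_proj G) (with_proj (map_graph f G))"
proof -
  interpret pair_graph G by fact
  let ?h = "\<lparr>iso_verts = f, iso_arcs = map_prod f f, iso_head = snd, iso_tail = fst\<rparr>"
  have "parcs G \<subseteq> pverts G \<times> pverts G" using assms(1) by (simp add: pair_graph_iff)
  then have "inj_on (map_prod f f) (parcs G)"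
    using map_prod_inj_on[OF assms(2,2)] inj_on_subset by blast
  then have "pre_digraph.digraph_isomorphism (with_proj G) ?h"
    using assms(2) wf_digraph by (simp add: pre_digraph.digraph_isomorphism_def)
  moreover have "with_proj (map_graph f G) = app_iso ?h (with_proj G)"
    by (simp add: map_graph_def with_proj_def app_iso_def)
  ultimately show ?thesis unfolding digraph_iso_def by blast
qed

context
  fixes f :: "'a \<Rightarrow> 'b" and G :: "'a pair_pre_digraph"
  assumes G: "pair_graph G" and inj: "inj_on f (pverts G)"
begin

lemma nbhd_map_graph:
  assumes "x \<in> pverts G"
  shows "nbhd (map_graph f G) (f x) = f ` nbhd G x"
proof -
  have "(f x, y) \<in> map_prod f f ` parcs G \<longleftrightarrow> y \<in> f ` nbhd G x" for y
  proof
    assume "(f x, y) \<in> map_prod f f ` parcs G"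
    then obtain a b where ab: "(a, b) \<in> parcs G" "f x = f a" "y = f b" by auto
    then have "a = x" using inj_onD[OF inj] pair_graphD(2)[OF G] assms by metis
    then show "y \<in> f ` nbhd G x" using ab by auto
  qed force
  then show ?thesis unfolding nbhd_def map_graph_def by auto
qed

lemma nbhd_subset: "nbhd G x \<subseteq> pverts G"
  using pair_graphD(3)[OF G] by auto

lemma card_nbhd_map_graph: "x \<in> pverts G \<Longrightarrow> card (nbhd (map_graph f G) (f x)) = card (nbhd G x)"
  using card_image[OF inj_on_subset[OF inj nbhd_subset]] by (simp add: nbhd_map_graph)

lemma pverts_map_graph: "pverts (map_graph f G) = f ` pverts G"
  by (simp add: map_graph_def)

lemma leaf_set_map_graph: "leaf_set (map_graph f G) = f ` leaf_set G"
  by (auto simp: leaf_set_def card_nbhd_map_graph pverts_map_graph)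

lemma support_set_map_graph: "support_set (map_graph f G) = f ` support_set G"
proof -
  have "(\<exists>u\<in>nbhd (map_graph f G) (f x). card (nbhd (map_graph f G) u) = 1) \<longleftrightarrow>
      (\<exists>u\<in>nbhd G x. card (nbhd G u) = 1)" if "x \<in> pverts G" for x
    unfolding nbhd_map_graph[OF that] bex_simps
    using card_nbhd_map_graph nbhd_subset by (metis (no_types, lifting) subsetD)
  then show ?thesis
    unfolding support_set_def pverts_map_graph by blast
qed

lemma link_set_map_graph: "link_set (map_graph f G) = f ` link_set G"
proof -
  have sub: "leaf_set G \<subseteq> pverts G" "support_set G \<subseteq> pverts G"
    by (auto simp: leaf_set_def support_set_def)
  have image_subset: "f ` nbhd G x \<subseteq> f ` support_set G \<longleftrightarrow> nbhd G x \<subseteq> support_set G" for x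
    using inj_on_image_mem_iff[OF inj subsetD[OF nbhd_subset] sub(2)] by blast
  have "f x \<in> link_set (map_graph f G) \<longleftrightarrow> x \<in> link_set G" if "x \<in> pverts G" for x
    unfolding link_set_def leaf_set_map_graph support_set_map_graph pverts_map_graph
    using that nbhd_map_graph[OF that] nbhd_subset[of x] sub inj
      image_subset[of x]
    by (simp add: inj_on_image_mem_iff)
  moreover have "link_set (map_graph f G) \<subseteq> f ` pverts G" "link_set G \<subseteq> pverts G"
    by (auto simp: link_set_def pverts_map_graph)
  ultimately show ?thesis by blast
qed

lemma ld_value_map_graph: "ld_value (map_graph f G) = ld_value G"
proof -
  have "card (f ` A) = card A" if "A \<subseteq> pverts G" for A
    using card_image inj_on_subset[OF inj that] by blast
  moreover have "leaf_set G \<subseteq> pverts G" "support_set G \<subseteq> pverts G" "link_set G \<subseteq> pverts G"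
    by (auto simp: leaf_set_def support_set_def link_set_def)
  ultimately show ?thesis
    by (simp add: ld_value_def leaf_set_map_graph support_set_map_graph link_set_map_graph pverts_map_graph)
qed

lemma pair_graph_map_graph: "pair_graph (map_graph f G)"
proof -
  note P = pair_graphD[OF G]
  have "irrefl (map_prod f f ` parcs G)"
    using P(2,3,5) inj_onD[OF inj] by (fastforce simp: irrefl_def)
  moreover have "sym (map_prod f f ` parcs G)" using P(4) by (force simp: sym_def)
  ultimately show ?thesis
    using P(1,2,3) by (fastforce simp: pair_graph_iff map_graph_def)
qed

lemma proper_graph_map_graph:
  assumes "proper_graph G"
  shows "proper_graph (map_graph f G)"
  unfolding proper_graph_def
proof (intro conjI ballI allI impI)
  fix y assume "y \<in> pverts (map_graph f G)"
  then obtain x where "x \<in> pverts G" "y = f x" by (auto simp: pverts_map_graph)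
  then show "nbhd (map_graph f G) y \<noteq> {}"
    using assms by (simp add: nbhd_map_graph proper_graph_def)
next
  fix y z assume yz: "(y, z) \<in> parcs (map_graph f G)"
    "card (nbhd (map_graph f G) y) = 1" "card (nbhd (map_graph f G) z) = 1"
  then obtain a b where ab: "(a, b) \<in> parcs G" "y = f a" "z = f b" by (auto simp: map_graph_def)
  then have "a \<in> pverts G" "b \<in> pverts G" using pair_graphD(2,3)[OF G] by blast+
  then have "pverts G = {a, b}"
    using yz ab assms by (simp add: card_nbhd_map_graph proper_graph_def)
  then show "pverts (map_graph f G) = {y, z}" using ab by (simp add: pverts_map_graph)
qed (fact pair_graph_map_graph)

lemma gamma_LD_map_graph_le: "gamma_LD (map_graph f G) \<le> gamma_LD G"
proof -
  obtain S where S: "locating_dominating G S" "card S = gamma_LD G" by (rule gamma_LD_attained)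
  note SV = locating_dominatingD(1)[OF S(1)]
  have nb: "nbhd (map_graph f G) (f x) \<inter> f ` S = f ` (nbhd G x \<inter> S)" if "x \<in> pverts G" for x
    using nbhd_map_graph[OF that] inj_on_image_Int[OF inj nbhd_subset SV] by simp
  have "locating_dominating (map_graph f G) (f ` S)"
  proof (rule locating_dominatingI)
    show "f ` S \<subseteq> pverts (map_graph f G)" using SV by (auto simp: pverts_map_graph)
  next
    fix y assume "y \<in> pverts (map_graph f G)" "y \<notin> f ` S"
    then obtain x where "x \<in> pverts G" "x \<notin> S" "y = f x" by (auto simp: pverts_map_graph)
    then show "nbhd (map_graph f G) y \<inter> f ` S \<noteq> {}"
      using nb locating_dominatingD(2)[OF S(1)] by simp
  next
    fix y z assume "y \<in> pverts (map_graph f G)" "y \<notin> f ` S" "z \<in> pverts (map_graph f G)" "z \<notin> f ` S"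
      and eq: "nbhd (map_graph f G) y \<inter> f ` S = nbhd (map_graph f G) z \<inter> f ` S"
    then obtain a b where ab: "a \<in> pverts G" "a \<notin> S" "y = f a" "b \<in> pverts G" "b \<notin> S" "z = f b"
      by (auto simp: pverts_map_graph)
    have "f ` (nbhd G a \<inter> S) = f ` (nbhd G b \<inter> S)" using eq ab nb by simp
    then have "nbhd G a \<inter> S = nbhd G b \<inter> S"
      using inj_on_image_eq_iff[OF inj, of "nbhd G a \<inter> S" "nbhd G b \<inter> S"] SV by auto
    then show "y = z" using locating_dominatingD(3)[OF S(1)] ab by blast
  qed
  then have "gamma_LD (map_graph f G) \<le> card (f ` S)" by (rule gamma_LD_le)
  also have "\<dots> = card S" by (rule card_image[OF inj_on_subset[OF inj SV]])
  finally show ?thesis using S(2) by simp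
qed

end

text \<open>The inequality for \<open>f\<close> is applied once more to its inverse on the
  image.\<close>

lemma gamma_LD_map_graph:
  assumes G: "pair_graph G" and inj: "inj_on f (pverts G)"
  shows "gamma_LD (map_graph f G) = gamma_LD G"
proof -
  let ?g = "inv_into (pverts G) f"
  have "map_prod ?g ?g (map_prod f f a) = a" if "a \<in> parcs G" for a
    using that inv_into_f_f[OF inj] pair_graphD(2,3)[OF G] by (cases a) auto
  then have "map_graph ?g (map_graph f G) = G"
    using inv_into_f_f[OF inj] by (simp add: map_graph_def image_image)
  moreover have "inj_on ?g (pverts (map_graph f G))"
    by (simp add: map_graph_def inj_on_inv_into)
  ultimately show ?thesis
    using gamma_LD_map_graph_le[OF G inj] gamma_LD_map_graph_le[OF pair_graph_map_graph[OF G inj], of ?g]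
    by simp
qed

section \<open>The family \<open>T_SL\<close>\<close>

lemma ld_value_eq:
  assumes "pair_graph G"
  shows "ld_value G = (real (card (pverts G)) + real (card (leaves G)) - real (card (support_vertices G))
    - real (card (support_links G))) / 2"
  using leaves_diff_supports[OF assms] by (simp add: ld_value_def support_links_eq)

text \<open>An isolated vertex is vacuously a support link: the formula gives 0 against
  \<open>gamma_LD\<close> = 1, and without the link term 1/2. Hence it fails both the equation and
  the defining condition of \<open>family_T\<close>.\<close>

lemma single_vertex:
  assumes "pair_graph G" "card (pverts G) = 1"
  shows "\<not> is_P2 G" "leaf_set G = {}" "support_set G = {}" "link_set G = pverts G" "gamma_LD G = 1"
proof -
  obtain x where x: "pverts G = {x}" using assms(2) by (rule card_1_singletonE)
  have nb: "nbhd G y = {}" for y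
    using pair_graphD(2,3,5)[OF assms(1)] x by (metis all_not_in_conv mem_nbhd singletonD)
  show "\<not> is_P2 G" using is_P2_sets(4) assms(2) by fastforce
  show "leaf_set G = {}" "support_set G = {}" by (auto simp: leaf_set_def support_set_def nb)
  then show "link_set G = pverts G" by (auto simp: link_set_def nb)
  obtain S where S: "locating_dominating G S" "card S = gamma_LD G" by (rule gamma_LD_attained)
  have "x \<in> S" using locating_dominatingD(2)[OF S(1), of x] x nb by auto
  then have "S = {x}" using locating_dominatingD(1)[OF S(1)] x by blast
  then show "gamma_LD G = 1" using S(2) by simp
qed

text \<open>Properness is carried along because additivity over a join presupposes it for the
  pieces.\<close>

lemma T_SL_proper_and_extremal:
  assumes "T \<in> T_SL"
  shows "proper_graph T \<and> real (gamma_LD T) = ld_value T"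
  using assms
proof induction
  case (base T)
  then have T: "undirected_tree T" by (simp add: family_T_def)
  note G = undirected_treeD(1)[OF T]
  have n: "card (pverts T) \<noteq> 1"
  proof
    assume "card (pverts T) = 1"
    then show False
      using base single_vertex[OF G] leaves_diff_supports[OF G] by (simp add: family_T_def)
  qed
  have "ld_value T \<le> real (gamma_LD T)"
  proof (cases "is_P2 T")
    case True
    obtain S where S: "locating_dominating T S" "card S = gamma_LD T" by (rule gamma_LD_attained)
    have "S \<noteq> {}" using locating_dominatingD(2)[OF S(1)] undirected_treeD(2)[OF T] by blast
    then have "card S \<noteq> 0"
      using finite_subset[OF locating_dominatingD(1)[OF S(1)] pair_graphD(1)[OF G]] by simp
    then have "1 \<le> gamma_LD T" using S(2) by simp
    then show ?thesis using is_P2_sets[OF True] by (simp add: ld_value_def)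
  next
    case False
    then have "real (gamma_LD T) = (real (card (pverts T)) + real (card (leaves T)) - real (card (support_vertices T))) / 2"
      using base by (simp add: family_T_def)
    \<comment> \<open>Subtracting the number of links can only lower the value, so
      \<open>ld_value T\<close> is at most \<open>gamma_LD T\<close>; the general upper bound then
      forces equality.\<close>
    then show ?thesis using ld_value_eq[OF G] by simp
  qed
  then show ?case
    using gamma_LD_le_ld_value[OF T n] undirected_tree_proper[OF T n] by simp
next
  case (join k T v w)
  interpret support_join k T v w
  proof
    show "v i \<in> support_set (T i)" if "i \<in> {1..k}" for i
      by (rule subsetD[OF support_vertices_subset]) (use join that in simp)
  qed (use join in auto)
  have "real (gamma_LD J) = ld_value J"
    using join gamma_LD_J ld_value_J by simp
  then show ?case using proper_graph_J by (simp add: J_def)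
next
  case (iso T T')
  obtain f where f: "inj_on f (pverts T)" "T' = map_graph f T"
    using digraph_iso_imp_map_graph[OF iso(2)] .
  moreover have "pair_graph T" using iso by (simp add: proper_graph_def)
  ultimately show ?case
    using iso proper_graph_map_graph gamma_LD_map_graph ld_value_map_graph by metis
qed

text \<open>The transposition is an automorphism of the P_2, possibly the identity, and fixes
  \<open>w\<close> and all other pieces; it merely moves the attachment from \<open>v j\<close> to
  \<open>b\<close>.\<close>

lemma (in support_join) transpose_in_P2:
  assumes j: "j \<in> {1..k}" "is_P2 (T j)" and b: "b \<in> pverts (T j)"
  shows "map_graph (Transposition.transpose (v j) b) (SL_join k T v w) = SL_join k T (v(j := b)) w"
proof -
  let ?f = "Transposition.transpose (v j) b"
  obtain p q where pq: "p \<noteq> q" "pverts (T j) = {p, q}" "parcs (T j) = {(p, q), (q, p)}"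
    using j(2) by (auto simp: is_P2_def)
  have outside: "?f x = x" if "x \<notin> pverts (T j)" for x
    using that b v_in[OF j(1)] by (metis transpose_apply_other)
  have fw: "?f w = w" using outside new j(1) by blast
  have id: "?f x = x" if "i \<in> {1..k}" "i \<noteq> j" "x \<in> pverts (T i)" for i x
    using outside same_index that j(1) by blast
  have cases: "v j = b \<or> v j = p \<and> b = q \<or> v j = q \<and> b = p"
    using b v_in[OF j(1)] pq by auto
  have verts: "?f ` pverts (T i) = pverts (T i)" if "i \<in> {1..k}" for i
  proof (cases "i = j")
    case True
    then show ?thesis using cases pq by (elim disjE conjE) auto
  qed (use id that in force)
  have arcs: "map_prod ?f ?f ` (parcs (T i) \<union> {(v i, w), (w, v i)}) =
      parcs (T i) \<union> {((v(j := b)) i, w), (w, (v(j := b)) i)}" if "i \<in> {1..k}" for i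
  proof (cases "i = j")
    case True
    then show ?thesis using cases pq fw by (elim disjE conjE) auto
  next
    case False
    then have "map_prod ?f ?f a = a" if "a \<in> parcs (T i)" for a
      using id \<open>i \<in> {1..k}\<close> pair_graphD(2,3)[OF pair] that by (cases a) auto
    then show ?thesis using False fw id[OF that False v_in[OF that]] by simp
  qed
  show ?thesis
    using verts arcs fw by (simp add: map_graph_def SL_join_def image_UN)
qed

text \<open>A chosen vertex of a $P_2$ need not be the one that counts as the support vertex by
  convention. Exchanging both vertices of these $P_2$, one after the other, is an isomorphism of
  the joins.\<close>

lemma (in support_join) J_in_T_SL:
  assumes T: "\<And>i. i \<in> {1..k} \<Longrightarrow> T i \<in> T_SL"
  shows "J \<in> T_SL"
proof -
  define u where "u = (\<lambda>i. if is_P2 (T i) then SOME x. x \<in> pverts (T i) else v i)"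
  have u: "u i \<in> support_vertices (T i)" if "i \<in> {1..k}" for i
    using support[OF that] by (simp add: u_def support_vertices_def support_set_def)
  have u_in: "u i \<in> pverts (T i)" if "i \<in> {1..k}" for i
    using u[OF that] support_vertices_subset[of "T i"] by (auto simp: support_set_def)
  \<comment> \<open>The first \<open>m\<close> attachments are already the desired ones, the others
    are the conventional ones. Indices start at 1, so \<open>c 0\<close> agrees with
    \<open>u\<close> on all pieces and \<open>c k\<close> with \<open>v\<close>.\<close>
  define c where "c m = (\<lambda>i. if i \<le> m then v i else u i)" for m
  have "SL_join k T (c m) w \<in> T_SL" if "m \<le> k" for m
    using that
  proof (induction m)
    case 0
    show ?case
      by (rule T_SL.join) (use two_le T u disjoint new in \<open>auto simp: c_def\<close>)
  next
    case (Suc m)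
    have j: "Suc m \<in> {1..k}" using Suc.prems by simp
    have c_Suc: "c (Suc m) = (c m)(Suc m := v (Suc m))"
      by (auto simp: c_def fun_eq_iff)
    interpret C: support_join k T "c m" w
    proof
      show "c m i \<in> support_set (T i)" if "i \<in> {1..k}" for i
        using support[OF that] u[OF that] support_vertices_subset[of "T i"] by (auto simp: c_def)
    qed (use two_le proper disjoint new in auto)
    show ?case
    proof (cases "is_P2 (T (Suc m))")
      case True
      have "SL_join k T (c (Suc m)) w =
          map_graph (Transposition.transpose (c m (Suc m)) (v (Suc m))) (SL_join k T (c m) w)"
        using C.transpose_in_P2[OF j True v_in[OF j]] by (simp add: c_Suc)
      moreover have "pair_graph (SL_join k T (c m) w)"
        using C.proper_graph_J by (simp add: proper_graph_def C.J_def)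
      ultimately show ?thesis
        using T_SL.iso[OF Suc.IH digraph_iso_map_graph] Suc.prems by simp
    next
      case False
      then have "c (Suc m) = c m" by (auto simp: c_def u_def fun_eq_iff le_Suc_eq)
      then show ?thesis using Suc by simp
    qed
  qed
  from this[of k] have "SL_join k T (c k) w \<in> T_SL" by simp
  moreover have "SL_join k T (c k) w = SL_join k T v w"
    by (simp add: SL_join_def c_def)
  ultimately show ?thesis by (simp add: J_def)
qed

text \<open>The gaps \<open>ld_value (P i) - gamma_LD (P i)\<close> are nonnegative and add up to
  the gap of the whole tree, which is 0; hence every piece is extremal and smaller. Without links
  the equation is the one defining \<open>family_T\<close>.\<close>

lemma extremal_tree_in_T_SL:
  assumes "undirected_tree T" "card (pverts T) \<noteq> 1" "real (gamma_LD T) = ld_value T"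
  shows "T \<in> T_SL"
  using assms
proof (induction "card (pverts T)" arbitrary: T rule: less_induct)
  case less
  show ?case
  proof (cases "link_set T = {}")
    case True
    then have "T \<in> family_T"
      using less.prems ld_value_eq[OF undirected_treeD(1)[OF less.prems(1)]]
      by (simp add: family_T_def support_links_eq)
    then show ?thesis by (rule T_SL.base)
  next
    case False
    then obtain w where "w \<in> link_set T" by blast
    then obtain k P v where split: "support_join k P v w" "T = SL_join k P v w"
      and P: "\<And>i. i \<in> {1..k} \<Longrightarrow> undirected_tree (P i)"
        "\<And>i. i \<in> {1..k} \<Longrightarrow> card (pverts (P i)) < card (pverts T)"
        "\<And>i. i \<in> {1..k} \<Longrightarrow> card (pverts (P i)) \<noteq> 1"
      using tree_split_at_link[OF less.prems(1,2)] by metis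
    interpret support_join k P v w by fact
    have le: "0 \<le> ld_value (P i) - real (gamma_LD (P i))" if "i \<in> {1..k}" for i
      using gamma_LD_le_ld_value[OF P(1,3)] that by simp
    have "(\<Sum>i\<in>{1..k}. ld_value (P i) - real (gamma_LD (P i))) = 0"
      using less.prems(3) gamma_LD_J ld_value_J split(2) by (simp add: J_def sum_subtractf)
    then have "ld_value (P i) - real (gamma_LD (P i)) = 0" if "i \<in> {1..k}" for i
      using sum_nonneg_eq_0_iff[of "{1..k}" "\<lambda>i. ld_value (P i) - real (gamma_LD (P i))"] le that by auto
    then have "P i \<in> T_SL" if "i \<in> {1..k}" for i
      using less.hyps P that by simp
    then show ?thesis using J_in_T_SL split(2) by (simp add: J_def)
  qed
qed

theorem theorem18:
  fixes T :: "'a pair_pre_digraph" and n :: nat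
  assumes "undirected_tree T" and "card (pverts T) = n"
  shows "real (gamma_LD T) =
           (real n + real (card (leaves T)) - real (card (support_vertices T))
              - real (card (support_links T))) / 2
         \<longleftrightarrow> T \<in> T_SL"
proof -
  note G = undirected_treeD(1)[OF assms(1)]
  have "real (gamma_LD T) = ld_value T \<longleftrightarrow> T \<in> T_SL"
  proof
    assume eq: "real (gamma_LD T) = ld_value T"
    have "card (pverts T) \<noteq> 1"
      using eq single_vertex[OF G] by (auto simp: ld_value_def)
    then show "T \<in> T_SL" using extremal_tree_in_T_SL assms(1) eq by blast
  qed (simp add: T_SL_proper_and_extremal)
  then show ?thesis using ld_value_eq[OF G] assms(2) by simp
qed

end
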